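(* Let $C_1^3,\dots,C_5^3$ be the code loops of rank $3$ with the following characteristic vectors: $$\lambda(C_1^3)=(1,1,1,1,1,1),\quad \lambda(C_2^3)=(0,0,0,0,0,0),\quad \lambda(C_3^3)=(0,0,0,1,1,1),$$ $$\lambda(C_4^3)=(1,1,0,0,0,0),\quad \lambda(C_5^3)=(1,0,0,0,0,0).$$ Then no two distinct loops in the list $C_1^3,\dots,C_5^3$ are isomorphic, and every nonassociative code loop of rank $3$ is isomorphic to one from this list.
   Context: For $u,v,w\in\mathbf F_2^m$ let $|v|$ be the number of coordinates equal to $1$, and $|u\cap v|$, $|u\cap v\cap w|$ the number of coordinates where all listed vectors equal $1$. A double even code is a subspace $V\subseteq\mathbf F_2^m$ with $|v|\equiv0\pmod 4$ and $|u\cap v|\equiv 0\pmod 2$ for all $u,v\in V$. There is a function $\phi:V\times V\to\{1,-1\}$ with $\phi(v,v)=(-1)^{|v|/4}$, $\phi(v,w)=(-1)^{|v\cap w|/2}\phi(w,v)$, $\phi(0,v)=\phi(v,0)=1$, $\phi(v+w,u)=\phi(v,w+u)\phi(v,w)\phi(w,u)(-1)^{|v\cap w\cap u|}$. The code loop $L(V)$ is the set $\{1,-1\}\times V$ with product $(\epsilon,v)(\delta,w)=(\epsilon\delta\,\phi(v,w),v+w)$; it is a Moufang loop, of rank $\dim_{\mathbf F_2}V$. A code loop is a loop isomorphic to some $L(V)$. All squares, commutators $[x,y]=x^{-1}y^{-1}xy$ and associators $(x,y,z)=((xy)z)(x(yz))^{-1}$ lie in the central subloop $\{1,-1\}$.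 If $L$ is a nonassociative code loop of rank $3$ with generators $a,b,c$ (elements whose images form a basis of $L/\{\pm1\}$), then $(a,b,c)=-1$, and the characteristic vector of $L$ with respect to $a,b,c$ is $\lambda(L)=(\lambda_1,\dots,\lambda_6)\in\mathbf F_2^6$ with $a^2=(-1)^{\lambda_1}$, $b^2=(-1)^{\lambda_2}$, $c^2=(-1)^{\lambda_3}$, $[a,b]=(-1)^{\lambda_4}$, $[a,c]=(-1)^{\lambda_5}$, $[b,c]=(-1)^{\lambda_6}$. The loops $C_i^3$ are nonassociative code loops of rank $3$ having generators with the stated characteristic vector. *)

theory Defs
  imports
    Complex_Main
    "HOL-Algebra.Group"
    "HOL-Library.Z2"
    "HOL-Library.Function_Algebras"
begin

section \<open>Binary vectors and doubly even codes\<close>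

text \<open>
  The space \<open>F\<^sub>2\<^sup>m\<close> is the set of those \<open>nat \<Rightarrow> bit\<close> that vanish outside \<open>{..<m}\<close>, so that
  \<open>m\<close> can be quantified inside a formula.  Addition is pointwise.
\<close>

type_synonym f2vec = "nat \<Rightarrow> bit"

definition f2_scale :: "bit \<Rightarrow> f2vec \<Rightarrow> f2vec" where
  "f2_scale c v = (\<lambda>i. c * v i)"

interpretation F2: vector_space f2_scale
  by unfold_locales (auto simp: f2_scale_def fun_eq_iff algebra_simps)

definition f2_space :: "nat \<Rightarrow> f2vec set" where
  "f2_space m = {v. \<forall>i\<ge>m. v i = 0}"

definition wt :: "f2vec \<Rightarrow> nat" where
  "wt v = card {i. v i = 1}"

definition wt2 :: "f2vec \<Rightarrow> f2vec \<Rightarrow> nat" where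
  "wt2 u v = card {i. u i = 1 \<and> v i = 1}"

definition wt3 :: "f2vec \<Rightarrow> f2vec \<Rightarrow> f2vec \<Rightarrow> nat" where
  "wt3 u v w = card {i. u i = 1 \<and> v i = 1 \<and> w i = 1}"

definition double_even_code :: "nat \<Rightarrow> f2vec set \<Rightarrow> bool" where
  "double_even_code m V \<longleftrightarrow>
     V \<subseteq> f2_space m \<and> F2.subspace V \<and>
     (\<forall>v\<in>V. 4 dvd wt v) \<and> (\<forall>u\<in>V. \<forall>v\<in>V. 2 dvd wt2 u v)"


section \<open>Code loops\<close>

text \<open>The signs \<open>1, -1\<close> are integers; only the values of \<open>\<phi>\<close> on \<open>V \<times> V\<close> matter.\<close>

definition code_cocycle :: "f2vec set \<Rightarrow> (f2vec \<Rightarrow> f2vec \<Rightarrow> int) \<Rightarrow> bool" where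
  "code_cocycle V \<phi> \<longleftrightarrow>
     (\<forall>v\<in>V. \<forall>w\<in>V. \<phi> v w \<in> {1, -1}) \<and>
     (\<forall>v\<in>V. \<phi> v v = (-1) ^ (wt v div 4)) \<and>
     (\<forall>v\<in>V. \<forall>w\<in>V. \<phi> v w = (-1) ^ (wt2 v w div 2) * \<phi> w v) \<and>
     (\<forall>v\<in>V. \<phi> 0 v = 1 \<and> \<phi> v 0 = 1) \<and>
     (\<forall>v\<in>V. \<forall>w\<in>V. \<forall>u\<in>V.
        \<phi> (v + w) u = \<phi> v (w + u) * \<phi> v w * \<phi> w u * (-1) ^ wt3 v w u)"

text \<open>
  Loops reuse the record type \<open>monoid\<close>, which carries no associativity law; likewise
  \<open>iso\<close>, \<open>\<cong>\<close> and \<open>m_inv\<close> only use the operation, the carrier and the unit.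
\<close>

definition code_loop_of ::
  "f2vec set \<Rightarrow> (f2vec \<Rightarrow> f2vec \<Rightarrow> int) \<Rightarrow> (int \<times> f2vec) monoid" where
  "code_loop_of V \<phi> =
     \<lparr> carrier = {1, -1} \<times> V,
       mult = (\<lambda>(\<epsilon>, v) (\<delta>, w). (\<epsilon> * \<delta> * \<phi> v w, v + w)),
       one = (1, 0) \<rparr>"

locale algebraic_loop =
  fixes L (structure)
  assumes m_closed: "\<lbrakk>x \<in> carrier L; y \<in> carrier L\<rbrakk> \<Longrightarrow> x \<otimes> y \<in> carrier L"
    and one_closed: "\<one> \<in> carrier L"
    and l_one: "x \<in> carrier L \<Longrightarrow> \<one> \<otimes> x = x"
    and r_one: "x \<in> carrier L \<Longrightarrow> x \<otimes> \<one> = x"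
    and l_div: "\<lbrakk>x \<in> carrier L; y \<in> carrier L\<rbrakk> \<Longrightarrow> \<exists>!z. z \<in> carrier L \<and> x \<otimes> z = y"
    and r_div: "\<lbrakk>x \<in> carrier L; y \<in> carrier L\<rbrakk> \<Longrightarrow> \<exists>!z. z \<in> carrier L \<and> z \<otimes> x = y"

definition code_loop_of_rank :: "('a, 'r) monoid_scheme \<Rightarrow> nat \<Rightarrow> bool" where
  "code_loop_of_rank L n \<longleftrightarrow>
     algebraic_loop L \<and>
     (\<exists>m V \<phi>. double_even_code m V \<and> code_cocycle V \<phi> \<and> F2.dim V = n \<and>
        L \<cong> code_loop_of V \<phi>)"

definition nonassociative :: "('a, 'r) monoid_scheme \<Rightarrow> bool" where
  "nonassociative L \<longleftrightarrow>
     (\<exists>x\<in>carrier L. \<exists>y\<in>carrier L. \<exists>z\<in>carrier L.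
        (x \<otimes>\<^bsub>L\<^esub> y) \<otimes>\<^bsub>L\<^esub> z \<noteq> x \<otimes>\<^bsub>L\<^esub> (y \<otimes>\<^bsub>L\<^esub> z))"


section \<open>Characteristic vectors\<close>

text \<open>
  Moufang loops are diassociative, so the bracketing of \<open>x\<inverse>y\<inverse>xy\<close> is immaterial.
\<close>

definition loop_commutator :: "('a, 'r) monoid_scheme \<Rightarrow> 'a \<Rightarrow> 'a \<Rightarrow> 'a" where
  "loop_commutator L x y = (inv\<^bsub>L\<^esub> x \<otimes>\<^bsub>L\<^esub> inv\<^bsub>L\<^esub> y) \<otimes>\<^bsub>L\<^esub> (x \<otimes>\<^bsub>L\<^esub> y)"

text \<open>The element \<open>(-1)\<^sup>s\<close> of the sign subloop of \<open>code_loop_of V \<phi>\<close>.\<close>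

definition sign_elem :: "bit \<Rightarrow> int \<times> f2vec" where
  "sign_elem s = (if s = 0 then 1 else -1, 0)"

type_synonym char_vec = "bit \<times> bit \<times> bit \<times> bit \<times> bit \<times> bit"

text \<open>
  An isomorphism \<open>h\<close> onto some \<open>code_loop_of V \<phi>\<close> transports the signs to \<open>L\<close> and identifies
  \<open>L/{\<plusminus>1}\<close> with \<open>V\<close> through the second component of \<open>h\<close>.  For nonassociative \<open>L\<close> the choice
  of \<open>h\<close> does not matter: \<open>-1\<close> is then the only nontrivial associator.
\<close>

definition has_char_vector_wrt ::
  "('a, 'r) monoid_scheme \<Rightarrow> 'a \<Rightarrow> 'a \<Rightarrow> 'a \<Rightarrow> char_vec \<Rightarrow> bool" where
  "has_char_vector_wrt L a b c = (\<lambda>(l1, l2, l3, l4, l5, l6).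
     \<exists>m V \<phi> h.
       double_even_code m V \<and> code_cocycle V \<phi> \<and> h \<in> iso L (code_loop_of V \<phi>) \<and>
       a \<in> carrier L \<and> b \<in> carrier L \<and> c \<in> carrier L \<and>
       distinct [snd (h a), snd (h b), snd (h c)] \<and>
       F2.independent {snd (h a), snd (h b), snd (h c)} \<and>
       F2.span {snd (h a), snd (h b), snd (h c)} = V \<and>
       h (a \<otimes>\<^bsub>L\<^esub> a) = sign_elem l1 \<and>
       h (b \<otimes>\<^bsub>L\<^esub> b) = sign_elem l2 \<and>
       h (c \<otimes>\<^bsub>L\<^esub> c) = sign_elem l3 \<and>
       h (loop_commutator L a b) = sign_elem l4 \<and>
       h (loop_commutator L a c) = sign_elem l5 \<and>
       h (loop_commutator L b c) = sign_elem l6)"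

definition has_char_vector :: "('a, 'r) monoid_scheme \<Rightarrow> char_vec \<Rightarrow> bool" where
  "has_char_vector L lam \<longleftrightarrow> (\<exists>a b c. has_char_vector_wrt L a b c lam)"

text \<open>The vectors of \<open>C\<^sub>1\<^sup>3, \<dots>, C\<^sub>5\<^sup>3\<close>; only the indices 1 to 5 are meaningful.\<close>

definition lambda_C3 :: "nat \<Rightarrow> char_vec" where
  "lambda_C3 i =
     (if i = 1 then (1, 1, 1, 1, 1, 1)
      else if i = 2 then (0, 0, 0, 0, 0, 0)
      else if i = 3 then (0, 0, 0, 1, 1, 1)
      else if i = 4 then (1, 1, 0, 0, 0, 0)
      else (1, 0, 0, 0, 0, 0))"

definition is_C3 :: "nat \<Rightarrow> ('a, 'r) monoid_scheme \<Rightarrow> bool" where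
  "is_C3 i L \<longleftrightarrow>
     code_loop_of_rank L 3 \<and> nonassociative L \<and> has_char_vector L (lambda_C3 i)"

end

theory Submission
  imports Defs "HOL-Library.Product_Plus"
begin

text \<open>
  Write \<open>|v|/4\<close>, \<open>|v \<inter> w|/2\<close> and \<open>|u \<inter> v \<inter> w|\<close>, taken modulo 2, as \<open>quarter\<close>, \<open>half\<close> and \<open>trip\<close>.
  Then \<open>half\<close> polarizes \<open>quarter\<close> and \<open>trip\<close> polarizes \<open>half\<close>, so \<open>quarter\<close> is a cubic form, and the
  code loop is determined by it up to isomorphism: the cocycles of two codes with the same form
  differ by a symmetric cocycle of an elementary abelian 2-group, which splits.

  For a nonassociative loop of rank 3 the form is \<open>q = l1 x + l2 y + l3 z + l4 x y + l5 x z + l6 y z + x y z\<close>,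
  where \<open>l\<close> is the characteristic vector.  The points of the Fano plane with \<open>q = 1\<close> form a set of
  odd size, and \<open>GL\<^sub>3(F\<^sub>2)\<close> has five orbits on such sets: the whole plane, a point, a line, the
  complement of two points, a triangle.  These belong to \<open>C\<^sub>1\<^sup>3, \<dots>, C\<^sub>5\<^sup>3\<close>, in this order.  They are told
  apart in the loop by the number of elements \<open>x\<close> with \<open>x\<^sup>2 \<noteq> 1\<close>, and the line from the triangle by
  the existence of \<open>x\<close>, \<open>y\<close> such that none of \<open>x\<close>, \<open>y\<close>, \<open>x y\<close> squares to \<open>1\<close>.
\<close>

text \<open>Bit arithmetic stays in ring form, so that identities over F2 can be settled by
  polynomial normalization.\<close>

declare add_bit_eq_xor [simp del] mult_bit_eq_and [simp del]

subsection \<open>Bits and signs\<close>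

lemma bit_mult_self: "x * x = (x :: bit)" "x * (x * y) = (x * y :: bit)"
  by (cases x; simp)+

lemma bit_add_self: "x + x = (0 :: bit)" "x + (x + y) = (y :: bit)"
  by (cases x; cases y; simp)+

text \<open>Normalization of Boolean polynomials: idempotent products make them multilinear, and
  equal monomials cancel in pairs.\<close>

lemmas bit_ring = ac_simps distrib_left distrib_right bit_mult_self bit_add_self

text \<open>The isomorphism from the additive group F2 to the signs; through it multiplicative
  cocycle conditions become additive.\<close>

definition sgnb :: "bit \<Rightarrow> int" where
  "sgnb s = (if s = 0 then 1 else -1)"

lemma sgnb_simps [simp]: "sgnb 0 = 1" "sgnb 1 = -1"
  by (simp_all add: sgnb_def)

lemma sgnb_add: "sgnb (s + t) = sgnb s * sgnb t"
  by (cases s; cases t) simp_all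

lemma sgnb_eq_iff [simp]: "sgnb s = sgnb t \<longleftrightarrow> s = t"
  by (cases s; cases t) simp_all

lemma sgnb_eq_1_iff [simp]: "sgnb s = 1 \<longleftrightarrow> s = 0"
  by (cases s) simp_all

lemma sgnb_square [simp]: "sgnb s * sgnb s = 1"
  by (cases s) simp_all

lemma sgnb_in: "sgnb s \<in> {1, -1}"
  by (cases s) simp_all

lemma minus_one_power_eq_sgnb: "(-1) ^ n = sgnb (of_nat n)"
  by (induction n) (simp_all add: sgnb_add)

lemma sign_elem_eq: "sign_elem s = (sgnb s, 0)"
  by (simp add: sign_elem_def sgnb_def)

lemma f2vec_add_self [simp]: "v + v = (0 :: f2vec)" "v + (v + w) = (w :: f2vec)"
  by (simp_all add: fun_eq_iff bit_add_self)

lemma f2vec_diff [simp]: "v - w = (v + w :: f2vec)"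
  by (simp add: fun_eq_iff)

lemma f2_scale_simps [simp]: "f2_scale 0 v = 0" "f2_scale 1 v = v"
  by (simp_all add: f2_scale_def fun_eq_iff)

lemma F2_subspace_iff: "F2.subspace V \<longleftrightarrow> 0 \<in> V \<and> (\<forall>v\<in>V. \<forall>w\<in>V. v + w \<in> V)"
proof -
  have "f2_scale c v \<in> V" if "0 \<in> V" "v \<in> V" for c v
    using that by (cases c) auto
  then show ?thesis by (auto simp: F2.subspace_def)
qed

subsection \<open>Weights modulo powers of two\<close>

text \<open>The pointwise product is the indicator of the intersection. All weights thus reduce to
  \<open>wt\<close>, and their symmetries to commutativity of the product.\<close>

lemma wt2_eq_wt: "wt2 u v = wt (u * v)"
  by (simp add: wt_def wt2_def bit_not_zero_iff[symmetric] del: bit_not_zero_iff)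

lemma wt3_eq_wt: "wt3 u v w = wt (u * v * w)"
  by (simp add: wt_def wt3_def bit_not_zero_iff[symmetric] del: bit_not_zero_iff)

lemma finite_support: "v \<in> f2_space m \<Longrightarrow> finite {i. v i = 1}"
  by (rule finite_subset[of _ "{..<m}"]) (auto simp: f2_space_def not_less, metis not_less zero_neq_one)

lemma f2_space_mult: "u \<in> f2_space m \<Longrightarrow> u * v \<in> f2_space m"
  by (simp add: f2_space_def)

lemma F2_subspace_f2_space: "F2.subspace (f2_space m)"
  by (auto simp: F2_subspace_iff f2_space_def)

text \<open>Addition of indicators is symmetric difference, so the common support is lost from both
  summands.\<close>

lemma wt_add:
  assumes "u \<in> f2_space m" "v \<in> f2_space m"
  shows "wt (u + v) + 2 * wt2 u v = wt u + wt v"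
proof -
  let ?U = "{i. u i = 1}" and ?V = "{i. v i = 1}"
  have fin: "finite ?U" "finite ?V"
    using assms finite_support by auto
  have "{i. (u + v) i = 1} = (?U - ?V) \<union> (?V - ?U)"
  proof -
    have "x + y = 1 \<longleftrightarrow> (x = 1 \<and> y \<noteq> 1) \<or> (y = 1 \<and> x \<noteq> 1)" for x y :: bit
      by (cases x; cases y) simp_all
    then show ?thesis by auto
  qed
  moreover have "wt2 u v = card (?U \<inter> ?V)"
    by (simp add: wt2_def Collect_conj_eq)
  moreover have "card ?U = card (?U - ?V) + card (?U \<inter> ?V)"
    using fin by (metis Int_Diff_Un Int_Diff_disjoint add.commute card_Un_disjoint finite_Diff finite_Int)
  moreover have "card ?V = card (?V - ?U) + card (?U \<inter> ?V)"
    using fin by (metis Int_Diff_Un Int_Diff_disjoint Int_commute add.commute card_Un_disjoint finite_Diff finite_Int)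
  moreover have "card ((?U - ?V) \<union> (?V - ?U)) = card (?U - ?V) + card (?V - ?U)"
    using fin by (intro card_Un_disjoint) auto
  ultimately show ?thesis by (simp add: wt_def)
qed

text \<open>This is \<open>wt_add\<close> for \<open>u * w\<close> and \<open>v * w\<close>, whose
  product is \<open>u * v * w\<close> because bits are idempotent.\<close>

lemma wt2_add:
  assumes "u \<in> f2_space m" "v \<in> f2_space m"
  shows "wt2 (u + v) w + 2 * wt3 u v w = wt2 u w + wt2 v w"
proof -
  have "u * w * (v * w) = u * v * w"
    by (auto simp: fun_eq_iff bit_ring)
  then show ?thesis
    using wt_add[of "u * w" m "v * w"] assms
    by (simp add: wt2_eq_wt wt3_eq_wt f2_space_mult distrib_right)
qed

section \<open>The cubic form of a code and its polarizations\<close>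

definition quarter :: "f2vec \<Rightarrow> bit" where
  "quarter v = of_nat (wt v div 4)"

definition half :: "f2vec \<Rightarrow> f2vec \<Rightarrow> bit" where
  "half v w = of_nat (wt2 v w div 2)"

definition trip :: "f2vec \<Rightarrow> f2vec \<Rightarrow> f2vec \<Rightarrow> bit" where
  "trip u v w = of_nat (wt3 u v w)"

text \<open>Squares in a code loop are the signs of \<open>quarter\<close>, and commutators the
  signs of \<open>half\<close> (\<open>iso_square\<close>, \<open>iso_commutator\<close>), so the
  characteristic vector can be read off in the code.\<close>

definition char_vec_of :: "f2vec \<Rightarrow> f2vec \<Rightarrow> f2vec \<Rightarrow> char_vec" where
  "char_vec_of a b c = (quarter a, quarter b, quarter c, half a b, half a c, half b c)"

lemma half_commute: "half v w = half w v"
  by (simp add: half_def wt2_eq_wt mult.commute)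

lemma trip_commute: "trip u v w = trip v u w" "trip u v w = trip u w v"
  by (simp_all add: trip_def wt3_eq_wt ac_simps)

lemma wt_0 [simp]: "wt 0 = 0"
  by (simp add: wt_def)

lemma quarter_0 [simp]: "quarter 0 = 0"
  by (simp add: quarter_def)

lemma half_0 [simp]: "half 0 v = 0" "half v 0 = 0"
  by (simp_all add: half_def wt2_eq_wt)

lemma trip_0 [simp]: "trip 0 v w = 0" "trip v 0 w = 0" "trip v w 0 = 0"
  by (simp_all add: trip_def wt3_eq_wt)

locale doubly_even =
  fixes m V
  assumes code: "double_even_code m V"
begin

lemma subspace: "F2.subspace V"
  and in_space: "v \<in> V \<Longrightarrow> v \<in> f2_space m"
  and dvd_wt: "v \<in> V \<Longrightarrow> 4 dvd wt v"
  and dvd_wt2: "v \<in> V \<Longrightarrow> w \<in> V \<Longrightarrow> 2 dvd wt2 v w"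
  using code by (auto simp: double_even_code_def)

lemma zero_in [simp]: "0 \<in> V"
  and add_in [simp]: "v \<in> V \<Longrightarrow> w \<in> V \<Longrightarrow> v + w \<in> V"
  using subspace by (auto simp: F2_subspace_iff)

lemma scale_in [simp]: "v \<in> V \<Longrightarrow> f2_scale x v \<in> V"
  by (cases x) simp_all

text \<open>The identity \<open>wt_add\<close> divided by 4 and reduced modulo 2.\<close>

lemma quarter_add:
  assumes "v \<in> V" "w \<in> V"
  shows "quarter (v + w) = quarter v + quarter w + half v w"
proof -
  obtain i j k l where "wt v = 4 * i" "wt w = 4 * j" "wt2 v w = 2 * k" "wt (v + w) = 4 * l"
    using assms dvd_wt dvd_wt2 by (meson add_in dvdE)
  moreover from this have "l + k = i + j"
    using wt_add[OF in_space in_space] assms by fastforce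
  then have "of_nat l + of_nat k = (of_nat i + of_nat j :: bit)"
    by (metis of_nat_add)
  then have "of_nat l = (of_nat i + of_nat j + of_nat k :: bit)"
    by (metis bit_add_self(1) add.assoc add_0_right)
  ultimately show ?thesis
    by (simp add: quarter_def half_def)
qed

text \<open>The identity \<open>wt2_add\<close> divided by 2 and reduced modulo 2.\<close>

lemma half_add:
  assumes "u \<in> V" "v \<in> V" "w \<in> V"
  shows "half (u + v) w = half u w + half v w + trip u v w"
proof -
  obtain i j k where "wt2 u w = 2 * i" "wt2 v w = 2 * j" "wt2 (u + v) w = 2 * k"
    using assms dvd_wt2 by (meson add_in dvdE)
  moreover from this have "k + wt3 u v w = i + j"
    using wt2_add[OF in_space in_space, of u v w] assms by fastforce
  then have "of_nat k + of_nat (wt3 u v w) = (of_nat i + of_nat j :: bit)"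
    by (metis of_nat_add)
  then have "of_nat k = (of_nat i + of_nat j + of_nat (wt3 u v w) :: bit)"
    by (metis bit_add_self(1) add.assoc add_0_right)
  ultimately show ?thesis
    by (simp add: half_def trip_def)
qed

lemma half_add_right:
  assumes "u \<in> V" "v \<in> V" "w \<in> V"
  shows "half w (u + v) = half w u + half w v + trip u v w"
  using half_add[OF assms] by (simp add: half_commute)

lemma half_self: "v \<in> V \<Longrightarrow> half v v = 0"
proof -
  assume "v \<in> V"
  then obtain k where "wt v = 4 * k" using dvd_wt by blast
  moreover have "v * v = v" by (auto simp: fun_eq_iff bit_ring)
  ultimately show ?thesis by (simp add: half_def wt2_eq_wt)
qed

lemma trip_self: "v \<in> V \<Longrightarrow> w \<in> V \<Longrightarrow> trip v v w = 0"
proof -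
  assume "v \<in> V" "w \<in> V"
  then obtain k where "wt2 v w = 2 * k" using dvd_wt2 by blast
  moreover have "v * v = v" by (auto simp: fun_eq_iff bit_ring)
  ultimately show ?thesis by (simp add: trip_def wt3_eq_wt wt2_eq_wt)
qed

lemma trip_self': "v \<in> V \<Longrightarrow> w \<in> V \<Longrightarrow> trip v w w = 0" "v \<in> V \<Longrightarrow> w \<in> V \<Longrightarrow> trip v w v = 0"
  using trip_self trip_commute by metis+

lemma trip_add:
  assumes "u \<in> V" "v \<in> V"
  shows "trip (u + v) w x = trip u w x + trip v w x"
proof -
  \<comment> \<open>Modulo 2, \<open>trip\<close> is \<open>wt2\<close> against
    \<open>w * x\<close>. That product may lie outside \<open>V\<close>, but \<open>wt2_add\<close>
    constrains only the two summands.\<close>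
  have "wt2 (u + v) (w * x) + 2 * wt3 u v (w * x) = wt2 u (w * x) + wt2 v (w * x)"
    using assms in_space by (intro wt2_add) auto
  then have "of_nat (wt2 (u + v) (w * x)) = (of_nat (wt2 u (w * x)) + of_nat (wt2 v (w * x)) :: bit)"
    by (metis add_0_right bit_2_eq_0 mult_zero_left of_nat_add of_nat_mult of_nat_numeral)
  then show ?thesis
    by (simp add: trip_def wt3_eq_wt wt2_eq_wt mult.assoc)
qed

lemma trip_add':
  assumes "u \<in> V" "v \<in> V"
  shows "trip w (u + v) x = trip w u x + trip w v x" "trip w x (u + v) = trip w x u + trip w x v"
  using trip_add[OF assms] by (metis trip_commute)+

end

lemma scale_simps:
  "quarter (f2_scale x v) = x * quarter v"
  "half (f2_scale x v) w = x * half v w"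
  "half w (f2_scale x v) = x * half w v"
  "trip (f2_scale x v) u w = x * trip v u w"
  "trip u (f2_scale x v) w = x * trip u v w"
  "trip u w (f2_scale x v) = x * trip u w v"
  by (cases x; simp)+

text \<open>Evenness of intersections extends to the span in one argument, then by symmetry in the
  other. With even intersections, \<open>wt_add\<close> carries divisibility by 4 from summands to
  sums.\<close>

lemma double_even_code_span:
  assumes sub: "B \<subseteq> f2_space m" and four: "\<And>v. v \<in> B \<Longrightarrow> 4 dvd wt v"
    and two: "\<And>v w. v \<in> B \<Longrightarrow> w \<in> B \<Longrightarrow> 2 dvd wt2 v w"
  shows "double_even_code m (F2.span B)"
proof -
  have span: "F2.span B \<subseteq> f2_space m"
    using F2.span_minimal[OF sub F2_subspace_f2_space] .
  have wt2_sub: "F2.subspace {v \<in> f2_space m. 2 dvd wt2 v w}" for w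
    using F2_subspace_f2_space wt2_add[of _ m _ w]
    by (auto simp: F2_subspace_iff wt2_eq_wt[of 0]) (metis dvd_add_left_iff dvd_add dvd_triv_left)
  have comm: "wt2 v w = wt2 w v" for v w
    by (simp add: wt2_eq_wt mult.commute)
  have "F2.span B \<subseteq> {v \<in> f2_space m. 2 dvd wt2 v w}" if "w \<in> B" for w
    by (rule F2.span_minimal[OF _ wt2_sub]) (use that two sub in auto)
  then have "F2.span B \<subseteq> {v \<in> f2_space m. 2 dvd wt2 v w}" if "w \<in> F2.span B" for w
    by (intro F2.span_minimal[OF _ wt2_sub]) (use that sub comm in auto)
  then have two': "2 dvd wt2 v w" if "v \<in> F2.span B" "w \<in> F2.span B" for v w
    using that by auto
  have "F2.subspace {v \<in> F2.span B. 4 dvd wt v}"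
  proof -
    have "4 dvd wt (x + y)" if "x \<in> F2.span B" "y \<in> F2.span B" "4 dvd wt x" "4 dvd wt y" for x y
    proof -
      have "wt (x + y) + 2 * wt2 x y = wt x + wt y" "2 dvd wt2 x y"
        using that span by (auto intro!: wt_add two')
      moreover from this(2) have "4 dvd 2 * wt2 x y" by auto
      ultimately show ?thesis using that(3,4) by (metis dvd_add dvd_add_left_iff)
    qed
    then show ?thesis
      by (auto simp: F2_subspace_iff F2.span_zero F2.span_add)
  qed
  then have "F2.span B \<subseteq> {v \<in> F2.span B. 4 dvd wt v}"
    by (intro F2.span_minimal) (auto simp: F2.span_base four)
  then show ?thesis
    using span two' by (auto simp: double_even_code_def)
qed

subsection \<open>Cocycles with values in bits\<close>

text \<open>The conditions of \<open>code_cocycle\<close> in additive notation, where they are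
  linear equations over F2.\<close>

definition bit_cocycle :: "f2vec set \<Rightarrow> (f2vec \<Rightarrow> f2vec \<Rightarrow> bit) \<Rightarrow> bool" where
  "bit_cocycle V f \<longleftrightarrow>
     (\<forall>v\<in>V. f v v = quarter v) \<and>
     (\<forall>v\<in>V. \<forall>w\<in>V. f v w = half v w + f w v) \<and>
     (\<forall>v\<in>V. f 0 v = 0 \<and> f v 0 = 0) \<and>
     (\<forall>v\<in>V. \<forall>w\<in>V. \<forall>u\<in>V. f (v + w) u = f v (w + u) + f v w + f w u + trip v w u)"

lemma code_cocycle_iff:
  assumes V: "0 \<in> V" "\<And>v w. v \<in> V \<Longrightarrow> w \<in> V \<Longrightarrow> v + w \<in> V"
    and \<phi>: "\<And>v w. v \<in> V \<Longrightarrow> w \<in> V \<Longrightarrow> \<phi> v w = sgnb (f v w)"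
  shows "code_cocycle V \<phi> \<longleftrightarrow> bit_cocycle V f"
proof -
  have "sgnb (f v w) \<in> {1, -1}" for v w
    by (rule sgnb_in)
  then show ?thesis
    using V
    by (simp add: code_cocycle_def bit_cocycle_def \<phi> minus_one_power_eq_sgnb
        quarter_def half_def trip_def flip: sgnb_add cong: ball_cong)
qed

lemma code_cocycleD:
  assumes "code_cocycle V \<phi>"
  shows "v \<in> V \<Longrightarrow> w \<in> V \<Longrightarrow> \<phi> v w \<in> {1, -1}"
    and "v \<in> V \<Longrightarrow> \<phi> v v = sgnb (quarter v)"
    and "v \<in> V \<Longrightarrow> \<phi> 0 v = 1" "v \<in> V \<Longrightarrow> \<phi> v 0 = 1"
    and "v \<in> V \<Longrightarrow> w \<in> V \<Longrightarrow> u \<in> V \<Longrightarrow>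
           \<phi> (v + w) u = \<phi> v (w + u) * \<phi> v w * \<phi> w u * sgnb (trip v w u)"
  using assms unfolding code_cocycle_def quarter_def trip_def minus_one_power_eq_sgnb by blast+

lemma bit_cocycleD:
  assumes "bit_cocycle V f"
  shows "v \<in> V \<Longrightarrow> f v v = quarter v"
    and "v \<in> V \<Longrightarrow> w \<in> V \<Longrightarrow> f v w = half v w + f w v"
    and "v \<in> V \<Longrightarrow> f 0 v = 0" "v \<in> V \<Longrightarrow> f v 0 = 0"
    and "v \<in> V \<Longrightarrow> w \<in> V \<Longrightarrow> u \<in> V \<Longrightarrow>
           f (v + w) u = f v (w + u) + f v w + f w u + trip v w u"
  using assms unfolding bit_cocycle_def by blast+

lemma code_cocycle_bit:
  assumes "code_cocycle V \<phi>" "0 \<in> V" "\<And>v w. v \<in> V \<Longrightarrow> w \<in> V \<Longrightarrow> v + w \<in> V"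
  obtains f where "bit_cocycle V f" "\<And>v w. v \<in> V \<Longrightarrow> w \<in> V \<Longrightarrow> \<phi> v w = sgnb (f v w)"
proof -
  define f where "f v w = (if \<phi> v w = 1 then 0 else (1 :: bit))" for v w
  have "\<phi> v w = sgnb (f v w)" if "v \<in> V" "w \<in> V" for v w
    using code_cocycleD(1)[OF assms(1) that] by (auto simp: f_def)
  then show thesis
    using that assms code_cocycle_iff by metis
qed

text \<open>
  The symmetric cocycle \<open>\<psi>\<close> with \<open>\<psi> v v = 0\<close> describes a central extension of the code by
  \<open>{\<plusminus>1}\<close> that is an elementary abelian 2-group, so it splits.
\<close>

lemma cocycle_splits:
  fixes \<psi> :: "f2vec \<Rightarrow> f2vec \<Rightarrow> bit"
  assumes "finite B"
    and "\<And>v. v \<in> F2.span B \<Longrightarrow> \<psi> v v = 0"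
    and "\<And>v w. v \<in> F2.span B \<Longrightarrow> w \<in> F2.span B \<Longrightarrow> \<psi> v w = \<psi> w v"
    and "\<And>v w u. v \<in> F2.span B \<Longrightarrow> w \<in> F2.span B \<Longrightarrow> u \<in> F2.span B \<Longrightarrow>
           \<psi> (v + w) u = \<psi> v (w + u) + \<psi> v w + \<psi> w u"
  shows "\<exists>g. \<forall>v\<in>F2.span B. \<forall>w\<in>F2.span B. \<psi> v w = g v + g w + g (v + w)"
  using assms
proof (induction B)
  case empty
  then show ?case by (intro exI[of _ "\<lambda>_. 0"]) simp
next
  case (insert a B)
  let ?W = "F2.span B" and ?V = "F2.span (insert a B)"
  have sub: "v \<in> ?V" if "v \<in> ?W" for v
    using that F2.span_mono[of B "insert a B"] by auto
  have aV: "a \<in> ?V" by (simp add: F2.span_base)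
  note self = insert.prems(1) and sym = insert.prems(2) and coc = insert.prems(3)
  obtain g where g: "\<And>v w. v \<in> ?W \<Longrightarrow> w \<in> ?W \<Longrightarrow> \<psi> v w = g v + g w + g (v + w)"
    using insert.IH[OF self sym coc] sub by blast
  show ?case
  proof (cases "a \<in> ?W")
    case True
    then show ?thesis using g unfolding F2.span_redundant[OF True] by blast
  next
    case False
    \<comment> \<open>Over F2, adjoining \<open>a\<close> adds the single coset
      \<open>a + ?W\<close>.\<close>
    have V: "v \<in> ?V \<longleftrightarrow> v \<in> ?W \<or> a + v \<in> ?W" for v
    proof -
      have "(\<exists>k. v + f2_scale k a \<in> ?W) \<longleftrightarrow> v + 0 \<in> ?W \<or> v + a \<in> ?W"
        by (metis bit_not_zero_iff f2_scale_simps)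
      then show ?thesis by (simp add: F2.span_insert add.commute)
    qed
    have aW: "a + w \<notin> ?W" if "w \<in> ?W" for w
      using that False F2.span_add[of "a + w" B w] by (auto simp: add.assoc)
    \<comment> \<open>With the value 0 at \<open>a\<close>, the coboundary equation for
      \<open>a\<close> and \<open>w\<close> forces the value \<open>g w + \<psi> a w\<close> at
      \<open>a + w\<close>.\<close>
    define h where "h v = (if v \<in> ?W then g v else g (a + v) + \<psi> a (a + v))" for v
    have h: "h w = g w" "h (a + w) = g w + \<psi> a w" if "w \<in> ?W" for w
      using that aW by (simp_all add: h_def)
    have zero: "\<psi> 0 v = 0" if "v \<in> ?V" for v
      using coc[OF F2.span_zero F2.span_zero that] self[OF F2.span_zero]
      by (simp only: add_0 add_0_right bit_add_self)
    \<comment> \<open>The cocycle law at \<open>a\<close>, \<open>a\<close>, \<open>w\<close>, where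
      \<open>a + a\<close> and \<open>\<psi> a a\<close> vanish.\<close>
    have shift: "\<psi> a (a + w) = \<psi> a w" if "w \<in> ?W" for w
    proof -
      have "\<psi> 0 w = \<psi> a (a + w) + 0 + \<psi> a w"
        using coc[of a a w] self[of a] that sub aV by (metis f2vec_add_self(1))
      then show ?thesis
        using zero[OF sub[OF that]] by (metis add_0_right bit_add_self add.commute)
    qed
    have mixed: "\<psi> (a + v) w = h (a + v) + h w + h (a + v + w)" if "v \<in> ?W" "w \<in> ?W" for v w
    proof -
      have vw: "v + w \<in> ?W" using that by (rule F2.span_add)
      have "\<psi> (a + v) w = \<psi> a (v + w) + \<psi> a v + \<psi> v w"
        using coc[of a v w] that aV sub by blast
      moreover have "a + v + w = a + (v + w)" by (rule add.assoc)
      ultimately show ?thesis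
        by (simp only: g[OF that] h(1)[OF that(2)] h(2)[OF that(1)] h(2)[OF vw] bit_ring)
    qed
    \<comment> \<open>The cocycle law at \<open>a\<close>, \<open>v\<close>, \<open>a + w\<close>
      splits off \<open>a\<close>; symmetry reduces the remaining term to \<open>mixed\<close>, and
      \<open>shift\<close> removes the repeated \<open>a\<close>.\<close>
    have both: "\<psi> (a + v) (a + w) = h (a + v) + h (a + w) + h (a + v + (a + w))"
      if "v \<in> ?W" "w \<in> ?W" for v w
    proof -
      have vw: "v + w \<in> ?W" using that by (rule F2.span_add)
      have eq: "a + v + (a + w) = v + w" "v + (a + w) = a + (v + w)"
        by (simp_all add: add.left_commute add.assoc)
      have "\<psi> (a + v) (a + w) = \<psi> a (a + (v + w)) + \<psi> a v + \<psi> v (a + w)"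
        using coc[OF aV sub[OF that(1)] F2.span_add[OF aV sub[OF that(2)]]]
        by (simp only: eq)
      moreover have "\<psi> v (a + w) = h (a + w) + h v + h (a + w + v)"
        using mixed[OF that(2,1)] sym[OF sub[OF that(1)] F2.span_add[OF aV sub[OF that(2)]]]
        by (simp only:)
      moreover have "a + w + v = a + (v + w)" by (simp only: ac_simps)
      ultimately show ?thesis
        by (simp only: eq shift[OF vw] h(1)[OF that(1)] h(1)[OF vw] h(2)[OF that(1)]
            h(2)[OF that(2)] h(2)[OF vw] bit_ring add_0 add_0_right f2vec_add_self)
    qed
    have "\<psi> v w = h v + h w + h (v + w)" if v: "v \<in> ?V" and w: "w \<in> ?V" for v w
    proof -
      consider "v \<in> ?W" "w \<in> ?W" | "a + v \<in> ?W" "w \<in> ?W" | "v \<in> ?W" "a + w \<in> ?W"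
        | "a + v \<in> ?W" "a + w \<in> ?W"
        using v w V by blast
      then show ?thesis
      proof cases
        case 1
        then show ?thesis using g h by (simp add: F2.span_add)
      next
        case 2
        then show ?thesis using mixed[of "a + v" w] by simp
      next
        case 3
        then show ?thesis using mixed[of "a + w" v] sym[OF v w] by (simp add: ac_simps)
      next
        case 4
        then show ?thesis using both[of "a + v" "a + w"] by simp
      qed
    qed
    then show ?thesis by blast
  qed
qed

lemma code_loop_of_sel [simp]:
  "carrier (code_loop_of V \<phi>) = {1, -1} \<times> V"
  "x \<otimes>\<^bsub>code_loop_of V \<phi>\<^esub> y = (fst x * fst y * \<phi> (snd x) (snd y), snd x + snd y)"
  "\<one>\<^bsub>code_loop_of V \<phi>\<^esub> = (1, 0)"
  by (simp_all add: code_loop_of_def split: prod.split)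

text \<open>
  The commutator and associator parts of a cocycle are polarizations of \<open>quarter\<close>, so they are
  respected by \<open>S\<close> as soon as \<open>quarter\<close> is.
\<close>

lemma code_loop_of_iso:
  assumes V: "double_even_code m V" and V': "double_even_code m' V'"
    and \<phi>: "code_cocycle V \<phi>" and \<phi>': "code_cocycle V' \<phi>'"
    and B: "finite B" "V = F2.span B"
    and S: "bij_betw S V V'" and add: "\<And>v w. v \<in> V \<Longrightarrow> w \<in> V \<Longrightarrow> S (v + w) = S v + S w"
    and quarter: "\<And>v. v \<in> V \<Longrightarrow> quarter (S v) = quarter v"
  shows "code_loop_of V \<phi> \<cong> code_loop_of V' \<phi>'"
proof -
  interpret V: doubly_even m V by unfold_locales fact
  interpret V': doubly_even m' V' by unfold_locales fact
  have SV: "S v \<in> V'" if "v \<in> V" for v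
    using S that by (auto simp: bij_betw_def)
  have half: "half (S v) (S w) = half v w" if "v \<in> V" "w \<in> V" for v w
    using V.quarter_add[OF that] V'.quarter_add[of "S v" "S w"] quarter add SV that
    by (metis V.add_in add_left_cancel)
  have trip: "trip (S v) (S w) (S u) = trip v w u" if "v \<in> V" "w \<in> V" "u \<in> V" for v w u
    using V.half_add[OF that] V'.half_add[of "S v" "S w" "S u"] half add SV that
    by (metis V.add_in add_left_cancel)
  obtain f where f: "bit_cocycle V f" "\<And>v w. v \<in> V \<Longrightarrow> w \<in> V \<Longrightarrow> \<phi> v w = sgnb (f v w)"
    using code_cocycle_bit[OF \<phi>] by auto
  obtain f' where f': "bit_cocycle V' f'" "\<And>v w. v \<in> V' \<Longrightarrow> w \<in> V' \<Longrightarrow> \<phi>' v w = sgnb (f' v w)"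
    using code_cocycle_bit[OF \<phi>'] by auto
  \<comment> \<open>In the difference of the two cocycles the commutator and associator parts
    cancel. What remains is a symmetric cocycle that vanishes on the diagonal.\<close>
  define \<psi> where "\<psi> v w = f v w + f' (S v) (S w)" for v w
  have "\<exists>g. \<forall>v\<in>F2.span B. \<forall>w\<in>F2.span B. \<psi> v w = g v + g w + g (v + w)"
  proof (rule cocycle_splits[OF B(1)], fold B(2))
    show "\<psi> v v = 0" if "v \<in> V" for v
      using bit_cocycleD(1)[OF f(1)] bit_cocycleD(1)[OF f'(1)] that SV quarter
      by (simp add: \<psi>_def bit_add_self)
    show "\<psi> v w = \<psi> w v" if "v \<in> V" "w \<in> V" for v w
    proof -
      have "f v w = half v w + f w v" "f' (S v) (S w) = half v w + f' (S w) (S v)"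
        using bit_cocycleD(2)[OF f(1)] bit_cocycleD(2)[OF f'(1)] that SV half by metis+
      then show ?thesis by (simp only: \<psi>_def bit_ring)
    qed
    show "\<psi> (v + w) u = \<psi> v (w + u) + \<psi> v w + \<psi> w u" if "v \<in> V" "w \<in> V" "u \<in> V" for v w u
    proof -
      have "f (v + w) u = f v (w + u) + f v w + f w u + trip v w u"
        using bit_cocycleD(5)[OF f(1)] that by blast
      moreover have "f' (S v + S w) (S u) =
          f' (S v) (S w + S u) + f' (S v) (S w) + f' (S w) (S u) + trip v w u"
        using bit_cocycleD(5)[OF f'(1)] that SV trip by simp
      moreover have "\<psi> (v + w) u = f (v + w) u + f' (S v + S w) (S u)"
        "\<psi> v (w + u) = f v (w + u) + f' (S v) (S w + S u)"
        using that add by (simp_all add: \<psi>_def)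
      ultimately show ?thesis
        by (simp only: \<psi>_def bit_ring add_0_right)
    qed
  qed
  then obtain g where g: "\<And>v w. v \<in> V \<Longrightarrow> w \<in> V \<Longrightarrow> \<psi> v w = g v + g w + g (v + w)"
    unfolding B(2) by blast
  \<comment> \<open>The sign correction by \<open>g\<close> absorbs the coboundary by which the two
    cocycles differ.\<close>
  define F where "F = (\<lambda>(\<epsilon>, v). (\<epsilon> * sgnb (g v), S v))"
  have F_in: "F x \<in> {1, -1} \<times> V'" if "x \<in> {1, -1} \<times> V" for x
    using that SV sgnb_in[of "g (snd x)"] by (auto simp: F_def)
  have "F \<in> hom (code_loop_of V \<phi>) (code_loop_of V' \<phi>')"
  proof (rule homI)
    fix x assume "x \<in> carrier (code_loop_of V \<phi>)"
    then show "F x \<in> carrier (code_loop_of V' \<phi>')"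
      using F_in by simp
  next
    fix x y assume "x \<in> carrier (code_loop_of V \<phi>)" "y \<in> carrier (code_loop_of V \<phi>)"
    then obtain \<epsilon> v \<delta> w where xy: "x = (\<epsilon>, v)" "y = (\<delta>, w)" and vw: "v \<in> V" "w \<in> V" by auto
    have "f v w + g (v + w) = g v + g w + f' (S v) (S w)"
      using g[OF vw] by (simp add: \<psi>_def) (metis add.assoc add.commute bit_add_self(2))
    then have "sgnb (f v w) * sgnb (g (v + w)) = sgnb (g v) * sgnb (g w) * sgnb (f' (S v) (S w))"
      by (metis sgnb_add)
    then show "F (x \<otimes>\<^bsub>code_loop_of V \<phi>\<^esub> y) = F x \<otimes>\<^bsub>code_loop_of V' \<phi>'\<^esub> F y"
      using vw SV f(2) f'(2) add by (simp add: F_def xy mult.assoc mult.left_commute)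
  qed
  moreover have "bij_betw F ({1, -1} \<times> V) ({1, -1} \<times> V')"
  proof (rule bij_betw_imageI)
    have "sgnb (g v) \<noteq> 0" for v by (simp add: sgnb_def)
    then show "inj_on F ({1, -1} \<times> V)"
      using S by (auto simp: inj_on_def F_def bij_betw_def)
    have "(\<epsilon>, S v) \<in> F ` ({1, -1} \<times> V)" if "\<epsilon> \<in> {1, -1}" "v \<in> V" for \<epsilon> v
    proof
      show "(\<epsilon>, S v) = F (\<epsilon> * sgnb (g v), v)" by (simp add: F_def mult.assoc)
      show "(\<epsilon> * sgnb (g v), v) \<in> {1, -1} \<times> V" using that sgnb_in[of "g v"] by auto
    qed
    then have "{1, -1} \<times> V' \<subseteq> F ` ({1, -1} \<times> V)"
      using S by (force simp: bij_betw_def)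
    moreover have "F ` ({1, -1} \<times> V) \<subseteq> {1, -1} \<times> V'"
      using F_in by blast
    ultimately show "F ` ({1, -1} \<times> V) = {1, -1} \<times> V'" by blast
  qed
  ultimately show ?thesis
    by (intro is_isoI) (simp add: iso_def)
qed

subsection \<open>Loops and their isomorphisms\<close>

lemma iso_mult:
  "h \<in> iso L M \<Longrightarrow> x \<in> carrier L \<Longrightarrow> y \<in> carrier L \<Longrightarrow> h (x \<otimes>\<^bsub>L\<^esub> y) = h x \<otimes>\<^bsub>M\<^esub> h y"
  by (simp add: iso_def hom_mult)

lemma iso_carrier: "h \<in> iso L M \<Longrightarrow> x \<in> carrier L \<Longrightarrow> h x \<in> carrier M"
  by (auto simp: iso_def hom_def)

lemma iso_eq_iff:
  "h \<in> iso L M \<Longrightarrow> x \<in> carrier L \<Longrightarrow> y \<in> carrier L \<Longrightarrow> h x = h y \<longleftrightarrow> x = y"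
  by (auto simp: iso_def bij_betw_def inj_on_def)

text \<open>The image of the unit is idempotent, and unique left division makes an idempotent equal
  to the unit.\<close>

lemma loop_iso_one:
  assumes L: "algebraic_loop L" and M: "algebraic_loop M" and h: "h \<in> iso L M"
  shows "h \<one>\<^bsub>L\<^esub> = \<one>\<^bsub>M\<^esub>"
proof -
  interpret L: algebraic_loop L by fact
  interpret M: algebraic_loop M by fact
  have h1: "h \<one>\<^bsub>L\<^esub> \<in> carrier M"
    using iso_carrier[OF h L.one_closed] .
  have "h \<one>\<^bsub>L\<^esub> \<otimes>\<^bsub>M\<^esub> h \<one>\<^bsub>L\<^esub> = h \<one>\<^bsub>L\<^esub>"
    using iso_mult[OF h L.one_closed L.one_closed] L.l_one[OF L.one_closed] by simp
  then show ?thesis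
    using M.l_div[OF h1 h1] M.r_one[OF h1] h1 M.one_closed by blast
qed

lemma loop_iso_sym:
  assumes L: "algebraic_loop L" and "L \<cong> M"
  shows "M \<cong> L"
proof -
  interpret L: algebraic_loop L by fact
  obtain h where h: "h \<in> iso L M"
    using assms(2) by (auto simp: is_iso_def)
  then have bij: "bij_betw h (carrier L) (carrier M)"
    by (simp add: iso_def)
  let ?g = "inv_into (carrier L) h"
  have g: "?g x \<in> carrier L" "h (?g x) = x" if "x \<in> carrier M" for x
    using that bij by (auto simp: bij_betw_def inv_into_into f_inv_into_f)
  have "?g (x \<otimes>\<^bsub>M\<^esub> y) = ?g x \<otimes>\<^bsub>L\<^esub> ?g y" if "x \<in> carrier M" "y \<in> carrier M" for x y
  proof -
    have "h (?g x \<otimes>\<^bsub>L\<^esub> ?g y) = x \<otimes>\<^bsub>M\<^esub> y"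
      using iso_mult[OF h] g that by simp
    then show ?thesis
      using inv_into_f_f[OF bij_betw_imp_inj_on[OF bij] L.m_closed[OF g(1) g(1)]] that by metis
  qed
  then have "?g \<in> iso M L"
    using g bij by (auto simp: iso_def intro!: homI bij_betw_inv_into)
  then show ?thesis by (rule is_isoI)
qed

lemma nonassociative_iso:
  assumes L: "algebraic_loop L" and "L \<cong> M" and "nonassociative L"
  shows "nonassociative M"
proof -
  interpret L: algebraic_loop L by fact
  obtain h where h: "h \<in> iso L M"
    using assms(2) by (auto simp: is_iso_def)
  obtain x y z where xyz: "x \<in> carrier L" "y \<in> carrier L" "z \<in> carrier L"
    and "(x \<otimes>\<^bsub>L\<^esub> y) \<otimes>\<^bsub>L\<^esub> z \<noteq> x \<otimes>\<^bsub>L\<^esub> (y \<otimes>\<^bsub>L\<^esub> z)"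
    using assms(3) by (auto simp: nonassociative_def)
  then have "h ((x \<otimes>\<^bsub>L\<^esub> y) \<otimes>\<^bsub>L\<^esub> z) \<noteq> h (x \<otimes>\<^bsub>L\<^esub> (y \<otimes>\<^bsub>L\<^esub> z))"
    using iso_eq_iff[OF h] L.m_closed by simp
  then have "(h x \<otimes>\<^bsub>M\<^esub> h y) \<otimes>\<^bsub>M\<^esub> h z \<noteq> h x \<otimes>\<^bsub>M\<^esub> (h y \<otimes>\<^bsub>M\<^esub> h z)"
    using iso_mult[OF h] L.m_closed xyz by simp
  then show ?thesis
    using iso_carrier[OF h] xyz by (auto simp: nonassociative_def)
qed

section \<open>Isomorphism invariants from squares\<close>

definition nonunit_squares :: "('a, 'r) monoid_scheme \<Rightarrow> 'a set" where
  "nonunit_squares L = {x \<in> carrier L. x \<otimes>\<^bsub>L\<^esub> x \<noteq> \<one>\<^bsub>L\<^esub>}"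

text \<open>For a code loop of rank 3 this means that the points with form value 1 contain a line of
  the Fano plane. The images of \<open>x\<close> and \<open>y\<close> are automatically distinct:
  otherwise \<open>x y\<close> would be a sign, with square 1.\<close>

definition has_nonunit_square_line :: "('a, 'r) monoid_scheme \<Rightarrow> bool" where
  "has_nonunit_square_line L \<longleftrightarrow>
     (\<exists>x\<in>nonunit_squares L. \<exists>y\<in>nonunit_squares L. x \<otimes>\<^bsub>L\<^esub> y \<in> nonunit_squares L)"

lemma nonunit_squares_iso:
  assumes L: "algebraic_loop L" and M: "algebraic_loop M" and h: "h \<in> iso L M"
  shows "bij_betw h (nonunit_squares L) (nonunit_squares M)"
proof -
  interpret L: algebraic_loop L by fact
  have *: "h x \<in> nonunit_squares M \<longleftrightarrow> x \<in> nonunit_squares L" if "x \<in> carrier L" for x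
    using that loop_iso_one[OF L M h] iso_mult[OF h that that] iso_carrier[OF h that]
      iso_eq_iff[OF h L.m_closed[OF that that] L.one_closed]
    by (simp add: nonunit_squares_def)
  have bij: "bij_betw h (carrier L) (carrier M)"
    using h by (simp add: iso_def)
  show ?thesis
  proof (rule bij_betw_imageI)
    show "inj_on h (nonunit_squares L)"
      using bij by (rule inj_on_subset[OF bij_betw_imp_inj_on]) (auto simp: nonunit_squares_def)
    show "h ` nonunit_squares L = nonunit_squares M"
      using * bij_betw_imp_surj_on[OF bij] by (fastforce simp: nonunit_squares_def)
  qed
qed

lemma loop_iso_invariants:
  assumes L: "algebraic_loop L" and M: "algebraic_loop M" and "L \<cong> M"
  shows "card (nonunit_squares L) = card (nonunit_squares M)"
    and "has_nonunit_square_line L \<Longrightarrow> has_nonunit_square_line M"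
proof -
  obtain h where h: "h \<in> iso L M"
    using assms(3) by (auto simp: is_iso_def)
  note bij = nonunit_squares_iso[OF L M h]
  show "card (nonunit_squares L) = card (nonunit_squares M)"
    using bij by (rule bij_betw_same_card)
  have in_car: "x \<in> carrier L" if "x \<in> nonunit_squares L" for x
    using that by (simp add: nonunit_squares_def)
  assume "has_nonunit_square_line L"
  then obtain x y where "x \<in> nonunit_squares L" "y \<in> nonunit_squares L"
    "x \<otimes>\<^bsub>L\<^esub> y \<in> nonunit_squares L"
    by (auto simp: has_nonunit_square_line_def)
  then show "has_nonunit_square_line M"
    using bij_betwE[OF bij] iso_mult[OF h in_car in_car] unfolding has_nonunit_square_line_def by metis
qed

section \<open>Multiplication, squares and commutators in a code loop\<close>

locale code_loop = doubly_even +
  fixes \<phi>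
  assumes cocycle: "code_cocycle V \<phi>"
begin

abbreviation M where "M \<equiv> code_loop_of V \<phi>"

lemmas cocycle_self = code_cocycleD(2)[OF cocycle]
  and cocycle_zero [simp] = code_cocycleD(3,4)[OF cocycle]
  and cocycle_add = code_cocycleD(5)[OF cocycle]

lemma cocycle_in: "v \<in> V \<Longrightarrow> w \<in> V \<Longrightarrow> \<phi> v w = 1 \<or> \<phi> v w = -1"
  using code_cocycleD(1)[OF cocycle] by blast

lemma cocycle_square [simp]:
  assumes "v \<in> V" "w \<in> V"
  shows "\<phi> v w * \<phi> v w = 1" "\<phi> v w * (\<phi> v w * n) = n"
  using cocycle_in[OF assms] by auto

lemma algebraic_loop: "algebraic_loop M"
proof (rule algebraic_loop.intro)
  fix x y assume xy: "x \<in> carrier M" "y \<in> carrier M"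
  then obtain \<epsilon> v \<delta> w where eq: "x = (\<epsilon>, v)" "y = (\<delta>, w)"
    and mem: "v \<in> V" "w \<in> V" "\<epsilon> \<in> {1, -1}" "\<delta> \<in> {1, -1}" by auto
  then have phi: "\<phi> v w \<in> {1, -1}" "\<phi> v (v + w) \<in> {1, -1}" "\<phi> (v + w) v \<in> {1, -1}"
    using cocycle_in by auto
  show "x \<otimes>\<^bsub>M\<^esub> y \<in> carrier M"
    using mem phi by (auto simp: eq)
  show "\<exists>!z. z \<in> carrier M \<and> x \<otimes>\<^bsub>M\<^esub> z = y"
  \<comment> \<open>The vector of the quotient must be \<open>v + w\<close>; its sign is solved for
    by using that signs are their own inverses.\<close>
  proof (rule ex1I[of _ "(\<epsilon> * \<delta> * \<phi> v (v + w), v + w)"])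
    show "(\<epsilon> * \<delta> * \<phi> v (v + w), v + w) \<in> carrier M \<and>
        x \<otimes>\<^bsub>M\<^esub> (\<epsilon> * \<delta> * \<phi> v (v + w), v + w) = y"
      using mem phi by (auto simp: eq)
    fix z assume z: "z \<in> carrier M \<and> x \<otimes>\<^bsub>M\<^esub> z = y"
    then have "w = v + snd z" "\<delta> = \<epsilon> * fst z * \<phi> v (snd z)" by (auto simp: eq)
    then show "z = (\<epsilon> * \<delta> * \<phi> v (v + w), v + w)"
      using z mem cocycle_in[of v "snd z"] by (auto simp: prod_eq_iff)
  qed
  show "\<exists>!z. z \<in> carrier M \<and> z \<otimes>\<^bsub>M\<^esub> x = y"
  proof (rule ex1I[of _ "(\<epsilon> * \<delta> * \<phi> (v + w) v, v + w)"])
    show "(\<epsilon> * \<delta> * \<phi> (v + w) v, v + w) \<in> carrier M \<and>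
        (\<epsilon> * \<delta> * \<phi> (v + w) v, v + w) \<otimes>\<^bsub>M\<^esub> x = y"
      using mem phi by (auto simp: eq ac_simps)
    fix z assume z: "z \<in> carrier M \<and> z \<otimes>\<^bsub>M\<^esub> x = y"
    then have "snd z = v + w" "\<delta> = \<epsilon> * fst z * \<phi> (snd z) v" by (auto simp: eq ac_simps)
    then show "z = (\<epsilon> * \<delta> * \<phi> (v + w) v, v + w)"
      using z mem cocycle_in[of "snd z" v] by (auto simp: prod_eq_iff)
  qed
qed auto

text \<open>By \<open>cocycle_add\<close>, the two bracketings of a triple differ exactly by the
  sign of \<open>trip\<close>.\<close>

lemma nonassociative_iff: "nonassociative M \<longleftrightarrow> (\<exists>u\<in>V. \<exists>v\<in>V. \<exists>w\<in>V. trip u v w = 1)"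
proof -
  have assoc: "(x \<otimes>\<^bsub>M\<^esub> y) \<otimes>\<^bsub>M\<^esub> z = x \<otimes>\<^bsub>M\<^esub> (y \<otimes>\<^bsub>M\<^esub> z) \<longleftrightarrow> trip (snd x) (snd y) (snd z) = 0"
    if "x \<in> carrier M" "y \<in> carrier M" "z \<in> carrier M" for x y z
  proof -
    obtain \<epsilon> u \<delta> v \<zeta> w where eq: "x = (\<epsilon>, u)" "y = (\<delta>, v)" "z = (\<zeta>, w)"
      by (metis surj_pair)
    have mem: "u \<in> V" "v \<in> V" "w \<in> V" "\<epsilon> \<noteq> 0" "\<delta> \<noteq> 0" "\<zeta> \<noteq> 0"
      using that by (auto simp: eq)
    have "\<phi> u (v + w) \<noteq> 0" "\<phi> v w \<noteq> 0"
      using cocycle_in[of u "v + w"] cocycle_in[of v w] mem by auto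
    then show ?thesis
      using mem by (simp add: eq cocycle_add ac_simps)
  qed
  have car: "(1, v) \<in> carrier M" if "v \<in> V" for v
    using that by simp
  show ?thesis
  proof
    assume "nonassociative M"
    then obtain x y z where xyz: "x \<in> carrier M" "y \<in> carrier M" "z \<in> carrier M"
      and "(x \<otimes>\<^bsub>M\<^esub> y) \<otimes>\<^bsub>M\<^esub> z \<noteq> x \<otimes>\<^bsub>M\<^esub> (y \<otimes>\<^bsub>M\<^esub> z)"
      unfolding nonassociative_def by blast
    then have "trip (snd x) (snd y) (snd z) = 1"
      using assoc[OF xyz] by (simp only: bit_not_zero_iff[symmetric] not_False_eq_True simp_thms)
    moreover have "snd x \<in> V" "snd y \<in> V" "snd z \<in> V"
      using xyz by (simp_all add: mem_Times_iff)
    ultimately show "\<exists>u\<in>V. \<exists>v\<in>V. \<exists>w\<in>V. trip u v w = 1" by blast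
  next
    assume "\<exists>u\<in>V. \<exists>v\<in>V. \<exists>w\<in>V. trip u v w = 1"
    then obtain u v w where uvw: "u \<in> V" "v \<in> V" "w \<in> V" "trip u v w = 1" by blast
    then have "((1, u) \<otimes>\<^bsub>M\<^esub> (1, v)) \<otimes>\<^bsub>M\<^esub> (1, w) \<noteq> (1, u) \<otimes>\<^bsub>M\<^esub> ((1, v) \<otimes>\<^bsub>M\<^esub> (1, w))"
      using assoc[OF car car car] by (metis snd_conv zero_neq_one)
    then show "nonassociative M"
      using car uvw unfolding nonassociative_def by blast
  qed
qed

lemma square: "x \<in> carrier M \<Longrightarrow> x \<otimes>\<^bsub>M\<^esub> x = (sgnb (quarter (snd x)), 0)"
proof -
  assume x: "x \<in> carrier M"
  obtain \<epsilon> v where eq: "x = (\<epsilon>, v)" by (metis surj_pair)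
  have "\<epsilon> * \<epsilon> = 1" "v \<in> V" using x by (auto simp: eq)
  then show ?thesis by (simp add: eq cocycle_self)
qed

lemma nonunit_squares: "nonunit_squares M = {1, -1} \<times> {v \<in> V. quarter v = 1}"
proof -
  have "x \<otimes>\<^bsub>M\<^esub> x \<noteq> \<one>\<^bsub>M\<^esub> \<longleftrightarrow> quarter (snd x) = 1" if "x \<in> carrier M" for x
    unfolding square[OF that] by simp
  then have "nonunit_squares M = {x \<in> carrier M. quarter (snd x) = 1}"
    unfolding nonunit_squares_def by blast
  then show ?thesis
    by (simp only: code_loop_of_sel(1) set_eq_iff mem_Collect_eq mem_Times_iff conj_assoc simp_thms)
qed

text \<open>A vector is its own negative, so an inverse only has to compensate the sign
  \<open>\<phi> v v\<close>. The inverse in \<open>L\<close> is a definite description, which unique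
  left division identifies.\<close>

lemma iso_inv:
  assumes L: "algebraic_loop L" and h: "h \<in> iso L M" and x: "x \<in> carrier L"
  shows "inv\<^bsub>L\<^esub> x \<in> carrier L"
    and "h (inv\<^bsub>L\<^esub> x) = (fst (h x) * \<phi> (snd (h x)) (snd (h x)), snd (h x))" (is "_ = ?y")
proof -
  interpret L: algebraic_loop L by fact
  have hx: "fst (h x) \<in> {1, -1}" "snd (h x) \<in> V"
    using iso_carrier[OF h x] by (auto simp: mem_Times_iff)
  then have y: "?y \<in> carrier M"
    using cocycle_in[OF hx(2) hx(2)] by auto
  have "h ` carrier L = carrier M"
    using h by (simp only: iso_def bij_betw_def mem_Collect_eq)
  then obtain z where z: "z \<in> carrier L" "h z = ?y"
    using y by (metis imageE)
  have "h x \<otimes>\<^bsub>M\<^esub> ?y = \<one>\<^bsub>M\<^esub>" "?y \<otimes>\<^bsub>M\<^esub> h x = \<one>\<^bsub>M\<^esub>"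
    using hx by (auto simp: ac_simps)
  then have "h (x \<otimes>\<^bsub>L\<^esub> z) = h \<one>\<^bsub>L\<^esub>" "h (z \<otimes>\<^bsub>L\<^esub> x) = h \<one>\<^bsub>L\<^esub>"
    using iso_mult[OF h] loop_iso_one[OF L algebraic_loop h] x z by simp_all
  then have eq: "x \<otimes>\<^bsub>L\<^esub> z = \<one>\<^bsub>L\<^esub>" "z \<otimes>\<^bsub>L\<^esub> x = \<one>\<^bsub>L\<^esub>"
    using iso_eq_iff[OF h] x z L.m_closed L.one_closed by simp_all
  have "inv\<^bsub>L\<^esub> x = z"
    unfolding m_inv_def
    using L.l_div[OF x L.one_closed] eq z(1) by (intro the_equality) blast+
  then show "inv\<^bsub>L\<^esub> x \<in> carrier L" "h (inv\<^bsub>L\<^esub> x) = ?y"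
    using z by simp_all
qed

lemma iso_square:
  assumes h: "h \<in> iso L M" and x: "x \<in> carrier L"
  shows "h (x \<otimes>\<^bsub>L\<^esub> x) = sign_elem (quarter (snd (h x)))"
proof -
  show ?thesis
    using iso_mult[OF h x x] square[OF iso_carrier[OF h x]] by (simp only: sign_elem_eq)
qed

text \<open>The factor \<open>\<phi> v w\<close> occurs twice and cancels. The diagonal values that
  remain form the polarization of \<open>quarter\<close>, which is \<open>half\<close>.\<close>

lemma iso_commutator:
  assumes L: "algebraic_loop L" and h: "h \<in> iso L M" and x: "x \<in> carrier L" and y: "y \<in> carrier L"
  shows "h (loop_commutator L x y) = sign_elem (half (snd (h x)) (snd (h y)))"
proof -
  interpret L: algebraic_loop L by fact
  obtain \<epsilon> v \<delta> w where eq: "h x = (\<epsilon>, v)" "h y = (\<delta>, w)" by fastforce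
  have mem: "\<epsilon> \<in> {1, -1}" "v \<in> V" "\<delta> \<in> {1, -1}" "w \<in> V"
    using iso_carrier[OF h x] iso_carrier[OF h y] by (auto simp: eq)
  have "h (loop_commutator L x y) =
      (h (inv\<^bsub>L\<^esub> x) \<otimes>\<^bsub>M\<^esub> h (inv\<^bsub>L\<^esub> y)) \<otimes>\<^bsub>M\<^esub> (h x \<otimes>\<^bsub>M\<^esub> h y)"
    using iso_mult[OF h] iso_inv(1)[OF L h] L.m_closed x y by (simp add: loop_commutator_def)
  also have "\<dots> = (\<phi> v v * \<phi> w w * \<phi> (v + w) (v + w), 0)"
  proof -
    have sq: "\<epsilon> * \<epsilon> = 1" "\<delta> * \<delta> = 1" using mem by auto
    have "\<epsilon> * \<phi> v v * (\<delta> * \<phi> w w) * \<phi> v w * (\<epsilon> * \<delta> * \<phi> v w) * \<phi> (v + w) (v + w) =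
        (\<epsilon> * \<epsilon>) * (\<delta> * \<delta>) * (\<phi> v w * \<phi> v w) * (\<phi> v v * \<phi> w w * \<phi> (v + w) (v + w))"
      by (simp only: ac_simps)
    also have "\<dots> = \<phi> v v * \<phi> w w * \<phi> (v + w) (v + w)"
      using cocycle_square(1)[OF mem(2,4)] sq by simp
    finally show ?thesis
      by (simp add: iso_inv(2)[OF L h] x y eq)
  qed
  also have "\<phi> v v * \<phi> w w * \<phi> (v + w) (v + w) = sgnb (half v w)"
    using mem by (simp add: cocycle_self quarter_add bit_ring flip: sgnb_add)
  finally show ?thesis by (simp only: eq sign_elem_eq snd_conv)
qed

end

subsection \<open>Codes of rank three\<close>

definition comb :: "f2vec \<Rightarrow> f2vec \<Rightarrow> f2vec \<Rightarrow> bit \<times> bit \<times> bit \<Rightarrow> f2vec" where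
  "comb a b c = (\<lambda>(x, y, z). f2_scale x a + f2_scale y b + f2_scale z c)"

lemma comb_add: "comb a b c (p + q) = comb a b c p + comb a b c q"
  by (cases p; cases q) (simp add: comb_def fun_eq_iff f2_scale_def algebra_simps)

lemma span_eq_range_comb: "F2.span {a, b, c} = range (comb a b c)"
proof -
  have "v \<in> F2.span {a, b, c} \<longleftrightarrow> v \<in> range (comb a b c)" for v
  proof -
    have "v \<in> F2.span {a, b, c} \<longleftrightarrow>
        (\<exists>x y z. v - f2_scale x a - f2_scale y b - f2_scale z c = 0)"
      by (simp only: F2.span_insert F2.span_empty mem_Collect_eq singleton_iff)
    also have "\<dots> \<longleftrightarrow> (\<exists>x y z. v = comb a b c (x, y, z))"
      by (simp only: comb_def prod.case diff_diff_eq right_minus_eq)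
    finally show ?thesis
      by (simp only: image_iff bex_UNIV split_paired_Ex)
  qed
  then show ?thesis by blast
qed

text \<open>The form \<open>quarter\<close> in the coordinates of a basis; the coefficient 1 of the
  cubic term is \<open>trip a b c\<close>.\<close>

definition char_poly :: "char_vec \<Rightarrow> bit \<times> bit \<times> bit \<Rightarrow> bit" where
  "char_poly = (\<lambda>(l1, l2, l3, l4, l5, l6) (x, y, z).
     l1 * x + l2 * y + l3 * z + l4 * x * y + l5 * x * z + l6 * y * z + x * y * z)"

text \<open>
  The bilinear part polarizes the quadratic part of \<open>char_poly\<close>; each of the remaining terms is one
  of the two summands obtained by splitting \<open>x y z\<close> into a pair and a single variable.
\<close>

definition cocycle_poly :: "char_vec \<Rightarrow> bit \<times> bit \<times> bit \<Rightarrow> bit \<times> bit \<times> bit \<Rightarrow> bit" where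
  "cocycle_poly = (\<lambda>(l1, l2, l3, l4, l5, l6) (x, y, z) (x', y', z').
     l1 * x * x' + l2 * y * y' + l3 * z * z' + l4 * x * y' + l5 * x * z' + l6 * y * z' +
     x * y * z' + x * z * y' + y * z * x')"

text \<open>The permanent of a 3 by 3 matrix, which over F2 is its determinant.\<close>

definition perm3 :: "bit \<times> bit \<times> bit \<Rightarrow> bit \<times> bit \<times> bit \<Rightarrow> bit \<times> bit \<times> bit \<Rightarrow> bit" where
  "perm3 = (\<lambda>(x, y, z) (x', y', z') (x'', y'', z'').
     x * y' * z'' + x * z' * y'' + y * x' * z'' + y * z' * x'' + z * x' * y'' + z * y' * x'')"

text \<open>This and the next three identities are the conditions of \<open>bit_cocycle\<close> in
  coordinates.\<close>

lemma cocycle_poly_self: "cocycle_poly l p p = char_poly l p"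
  by (cases l; cases p) (simp add: cocycle_poly_def char_poly_def bit_ring)

lemma cocycle_poly_swap:
  "cocycle_poly l p q = char_poly l (p + q) + char_poly l p + char_poly l q + cocycle_poly l q p"
  by (cases l; cases p; cases q) (simp add: cocycle_poly_def char_poly_def bit_ring)

lemma cocycle_poly_add:
  "cocycle_poly l (p + q) r =
     cocycle_poly l p (q + r) + cocycle_poly l p q + cocycle_poly l q r + perm3 p q r"
  by (cases l; cases p; cases q; cases r) (simp add: cocycle_poly_def perm3_def bit_ring)

lemma cocycle_poly_0: "cocycle_poly l 0 p = 0" "cocycle_poly l p 0 = 0"
  by (cases l; cases p; simp add: cocycle_poly_def zero_prod_def)+

context doubly_even
begin

lemma comb_in [simp]: "a \<in> V \<Longrightarrow> b \<in> V \<Longrightarrow> c \<in> V \<Longrightarrow> comb a b c p \<in> V"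
  by (cases p) (simp add: comb_def)

text \<open>\<open>trip\<close> is trilinear and alternating on the code, hence a multiple of the
  determinant.\<close>

lemma trip_comb:
  assumes "a \<in> V" "b \<in> V" "c \<in> V"
  shows "trip (comb a b c p) (comb a b c q) (comb a b c r) = perm3 p q r * trip a b c"
proof -
  have "trip a c b = trip a b c" "trip b a c = trip a b c" "trip b c a = trip a b c"
    "trip c a b = trip a b c" "trip c b a = trip a b c"
    by (metis trip_commute)+
  then show ?thesis
    using assms
    by (cases p; cases q; cases r)
      (simp add: comb_def perm3_def trip_add trip_add' scale_simps trip_self trip_self' bit_ring)
qed

text \<open>An alternating trilinear form vanishes on dependent triples.\<close>

lemma independent_of_trip:
  assumes "a \<in> V" "b \<in> V" "c \<in> V" and abc: "trip a b c = 1"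
  shows "distinct [a, b, c]" "F2.independent {a, b, c}"
proof -
  have ker: "F2.subspace {v \<in> V. trip v w x = 0}" for w x
    using trip_add by (auto simp: F2_subspace_iff)
  have span: "trip v w x = 0" if "v \<in> F2.span B" "\<And>u. u \<in> B \<Longrightarrow> u \<in> V \<and> trip u w x = 0" for v w x B
    using F2.span_minimal[OF _ ker, of B w x] that by blast
  show dist: "distinct [a, b, c]"
    using assms trip_self trip_self' by (metis distinct_length_2_or_more distinct_singleton zero_neq_one)
  have "a \<notin> F2.span {b, c}"
  proof
    assume "a \<in> F2.span {b, c}"
    then have "trip a b c = 0"
      using assms trip_self[of b c] trip_self'(2)[of c b] by (intro span) auto
    then show False using abc by simp
  qed
  moreover have "b \<notin> F2.span {c}"
  proof
    assume "b \<in> F2.span {c}"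
    then have "trip b a c = 0"
      using assms trip_self'(2)[of c a] by (intro span) auto
    then show False using abc trip_commute(1)[of a b c] by simp
  qed
  moreover have "c \<noteq> 0"
    using abc by auto
  ultimately show "F2.independent {a, b, c}"
    using dist by (simp add: F2.independent_insert)
qed

end

text \<open>By \<open>independent_of_trip\<close> the condition on \<open>trip\<close> includes
  linear independence, so the three vectors are a basis.\<close>

locale code_basis = doubly_even +
  fixes a b c
  assumes mem: "a \<in> V" "b \<in> V" "c \<in> V"
    and trip_abc: "trip a b c = 1" and span: "F2.span {a, b, c} = V"
begin

abbreviation "lam \<equiv> char_vec_of a b c"

lemma V_eq: "V = range (comb a b c)"
  using span[symmetric] unfolding span_eq_range_comb .

lemma quarter_comb: "quarter (comb a b c p) = char_poly lam p"
proof -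
  have "trip b c a = 1"
    using trip_abc by (metis trip_commute)
  then show ?thesis
    using mem trip_abc
    by (cases p) (simp add: comb_def char_poly_def char_vec_of_def quarter_add half_add
        half_add_right scale_simps bit_ring)
qed

lemma inj_comb: "inj (comb a b c)"
proof (rule injI)
  fix p q assume eq: "comb a b c p = comb a b c q"
  have tr: "perm3 p r s = perm3 q r s" for r s
    using trip_comb[OF mem, of p r s] trip_comb[OF mem, of q r s] by (simp add: eq trip_abc)
  show "p = q"
    \<comment> \<open>The determinant with two unit vectors reads off the remaining
      coordinate.\<close>
    using tr[of "(0, 1, 0)" "(0, 0, 1)"] tr[of "(1, 0, 0)" "(0, 0, 1)"] tr[of "(1, 0, 0)" "(0, 1, 0)"]
    by (cases p; cases q) (simp add: perm3_def)
qed

lemma bij_comb: "bij_betw (comb a b c) UNIV V"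
  by (intro bij_betw_imageI inj_comb V_eq[symmetric])

lemma dim_V: "F2.dim V = 3"
proof -
  have "F2.dim V = card {a, b, c}"
    using F2.dim_span_eq_card_independent[OF independent_of_trip(2)[OF mem trip_abc]]
    unfolding span .
  then show ?thesis
    using independent_of_trip(1)[OF mem trip_abc] by simp
qed

text \<open>The explicit \<open>cocycle_poly\<close>, transported along the coordinates of the
  basis, is a cocycle; this supplies the loops for the existence claim.\<close>

lemma cocycle_exists: "\<exists>\<phi>. code_cocycle V \<phi>"
proof -
  define co where "co = inv_into UNIV (comb a b c)"
  have co [simp]: "co (comb a b c p) = p" for p
    by (simp add: co_def inj_comb)
  have co_add: "comb a b c p + comb a b c q = comb a b c (p + q)" for p q
    by (simp only: comb_add)
  have comb_0: "comb a b c 0 = 0"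
    by (simp add: comb_def zero_prod_def)
  have co_0: "co 0 = 0"
    using co[of 0] by (simp only: comb_0)
  define f where "f v w = cocycle_poly lam (co v) (co w)" for v w
  have "bit_cocycle V f"
    unfolding bit_cocycle_def V_eq ball_simps
  proof (intro conjI allI)
    fix p q r
    let ?v = "comb a b c p" and ?w = "comb a b c q" and ?u = "comb a b c r"
    show "f ?v ?v = quarter ?v"
      by (simp only: f_def co cocycle_poly_self quarter_comb)
    have "half ?v ?w = quarter (?v + ?w) + quarter ?v + quarter ?w"
      using quarter_add[OF comb_in comb_in, OF mem mem, of p q] by (simp only: bit_ring add_0_right)
    then show "f ?v ?w = half ?v ?w + f ?w ?v"
      by (simp only: f_def co co_add quarter_comb cocycle_poly_swap[of _ p q])
    show "f 0 ?v = 0" "f ?v 0 = 0"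
      by (simp_all only: f_def co co_0 cocycle_poly_0)
    show "f (?v + ?w) ?u = f ?v (?w + ?u) + f ?v ?w + f ?w ?u + trip ?v ?w ?u"
      by (simp only: f_def co co_add cocycle_poly_add[of _ p q r] trip_comb[OF mem] trip_abc mult_1_right)
  qed
  then show ?thesis
    using code_cocycle_iff[of V "\<lambda>v w. sgnb (f v w)" f] by auto
qed

end

text \<open>Vectors with equal coordinates are matched. Both forms are then the same
  \<open>char_poly\<close>, so the matching preserves \<open>quarter\<close> and
  \<open>code_loop_of_iso\<close> applies.\<close>

lemma code_basis_iso:
  assumes "code_basis m V a b c" "code_basis m' V' a' b' c'"
    and lam: "char_vec_of a b c = char_vec_of a' b' c'"
    and \<phi>: "code_cocycle V \<phi>" "code_cocycle V' \<phi>'"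
  shows "code_loop_of V \<phi> \<cong> code_loop_of V' \<phi>'"
proof -
  interpret B: code_basis m V a b c by fact
  interpret B': code_basis m' V' a' b' c' by fact
  let ?T = "comb a b c" and ?T' = "comb a' b' c'"
  define S where "S v = ?T' (inv_into UNIV ?T v)" for v
  have S: "S (?T p) = ?T' p" for p
    by (simp add: S_def B.inj_comb)
  show ?thesis
  proof (rule code_loop_of_iso[OF B.code B'.code \<phi>, of "{a, b, c}" S])
    show "bij_betw S V V'"
      unfolding S_def using bij_betw_trans[OF bij_betw_inv_into[OF B.bij_comb] B'.bij_comb]
      by (simp add: comp_def)
    fix v w assume "v \<in> V" "w \<in> V"
    then obtain p q where eq: "v = ?T p" "w = ?T q"
      using B.V_eq by blast
    show "S (v + w) = S v + S w"
      unfolding eq comb_add[symmetric] S by (simp only: comb_add S)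
    show "quarter (S v) = quarter v"
      by (simp only: eq S B.quarter_comb B'.quarter_comb lam)
  qed (simp_all add: B.span)
qed

subsection \<open>Change of basis\<close>

text \<open>The three moves are the effects of passing from \<open>a\<close>, \<open>b\<close>,
  \<open>c\<close> to \<open>a + b\<close>, \<open>b\<close>, \<open>c\<close>, to \<open>b\<close>,
  \<open>a\<close>, \<open>c\<close> and to \<open>b\<close>, \<open>c\<close>, \<open>a\<close>.
  The summand 1 here is \<open>trip a b c\<close>, from \<open>half_add\<close>.\<close>

definition add_move :: "char_vec \<Rightarrow> char_vec" where
  "add_move = (\<lambda>(l1, l2, l3, l4, l5, l6). (l1 + l2 + l4, l2, l3, l4, l5 + l6 + 1, l6))"

definition swap_move :: "char_vec \<Rightarrow> char_vec" where
  "swap_move = (\<lambda>(l1, l2, l3, l4, l5, l6). (l2, l1, l3, l4, l6, l5))"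

definition rot_move :: "char_vec \<Rightarrow> char_vec" where
  "rot_move = (\<lambda>(l1, l2, l3, l4, l5, l6). (l2, l3, l1, l6, l4, l5))"

fun trace :: "('a \<Rightarrow> 'a) list \<Rightarrow> 'a \<Rightarrow> 'a list" where
  "trace [] x = [x]"
| "trace (f # fs) x = x # trace fs (f x)"

lemma trace_closed:
  assumes "x \<in> X" "\<And>f y. f \<in> set fs \<Longrightarrow> y \<in> X \<Longrightarrow> f y \<in> X"
  shows "set (trace fs x) \<subseteq> X"
  using assms by (induction fs arbitrary: x) auto

lemma bex_C3: "(\<exists>i\<in>{1..5}. P i) \<longleftrightarrow> P 1 \<or> P 2 \<or> P 3 \<or> P 4 \<or> P (5 :: nat)"
proof -
  have "{1..5} = {1, 2, 3, 4, 5 :: nat}" by auto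
  then show ?thesis by simp
qed

text \<open>
  This word of moves was found by computer search: from each of the 64 characteristic vectors the
  walk it prescribes passes through one of the five standard vectors.
\<close>

definition universal_walk :: "(char_vec \<Rightarrow> char_vec) list" where
  "universal_walk =
    [add_move, rot_move, rot_move, add_move, swap_move, add_move, rot_move, swap_move,
      add_move, rot_move, rot_move, add_move, rot_move, rot_move, add_move, rot_move,
      rot_move, add_move, swap_move, add_move, rot_move, swap_move, add_move, rot_move,
      rot_move, swap_move, add_move, rot_move, add_move, rot_move, add_move, rot_move,
      add_move]"

lemma universal_walk: "\<exists>i\<in>{1..5}. lambda_C3 i \<in> set (trace universal_walk l)"
proof -
  obtain l1 l2 l3 l4 l5 l6 where "l = (l1, l2, l3, l4, l5, l6)"
    by (metis surj_pair)
  then show ?thesis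
    unfolding bex_C3 universal_walk_def
    by (cases l1; cases l2; cases l3; cases l4; cases l5; cases l6)
      (simp_all add: lambda_C3_def add_move_def swap_move_def rot_move_def)
qed

context doubly_even
begin

lemma char_vec_of_moves:
  assumes "a \<in> V" "b \<in> V" "c \<in> V" "trip a b c = 1"
  shows "char_vec_of (a + b) b c = add_move (char_vec_of a b c)"
    and "char_vec_of b a c = swap_move (char_vec_of a b c)"
    and "char_vec_of b c a = rot_move (char_vec_of a b c)"
  using assms trip_self'(1)[of a b]
  by (simp_all add: char_vec_of_def add_move_def swap_move_def rot_move_def quarter_add half_add
      half_self half_commute[of b a] half_commute[of c a])

text \<open>The characteristic vectors of triples with \<open>trip\<close> equal to 1 are closed
  under the moves, so every vector on the universal walk is realized, among them a standard
  one.\<close>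

lemma standard_basis:
  assumes "u \<in> V" "v \<in> V" "w \<in> V" "trip u v w = 1"
  obtains i a b c where "i \<in> {1..5}" "a \<in> V" "b \<in> V" "c \<in> V" "trip a b c = 1"
    "char_vec_of a b c = lambda_C3 i"
proof -
  define X where
    "X = {char_vec_of a b c | a b c. a \<in> V \<and> b \<in> V \<and> c \<in> V \<and> trip a b c = 1}"
  have "f l \<in> X" if f: "f \<in> set universal_walk" and "l \<in> X" for f l
  proof -
    obtain a b c where l: "l = char_vec_of a b c"
      and abc: "a \<in> V" "b \<in> V" "c \<in> V" "trip a b c = 1"
      using \<open>l \<in> X\<close> by (auto simp: X_def)
    have "trip (a + b) b c = 1"
      using abc trip_add[of a b b c] trip_self[of b c] by simp
    moreover have "trip b a c = 1" "trip b c a = 1"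
      using abc(4) by (metis trip_commute)+
    ultimately have "char_vec_of (a + b) b c \<in> X" "char_vec_of b a c \<in> X" "char_vec_of b c a \<in> X"
      using abc(1-3) add_in[OF abc(1,2)] unfolding X_def by blast+
    moreover have "f = add_move \<or> f = swap_move \<or> f = rot_move"
      using f by (auto simp: universal_walk_def)
    ultimately show ?thesis
      unfolding l using char_vec_of_moves[OF abc] by metis
  qed
  moreover have "char_vec_of u v w \<in> X"
    using assms by (auto simp: X_def)
  ultimately have "set (trace universal_walk (char_vec_of u v w)) \<subseteq> X"
    by (intro trace_closed)
  then obtain i where "i \<in> {1..5}" "lambda_C3 i \<in> X"
    using universal_walk by blast
  then show thesis
    using that unfolding X_def by auto
qed

end

subsection \<open>Characteristic vectors and invariants\<close>

text \<open>A vector outside the span would give four independent vectors in a space spanned by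
  three.\<close>

lemma code_basisI:
  assumes "double_even_code m V" "F2.dim V = 3" "a \<in> V" "b \<in> V" "c \<in> V" "trip a b c = 1"
  shows "code_basis m V a b c"
proof -
  interpret doubly_even m V by unfold_locales fact
  note ind = independent_of_trip[OF assms(3-6)]
  have "V \<subseteq> F2.span {a, b, c}"
  proof
    fix v assume v: "v \<in> V"
    obtain B where B: "V \<subseteq> F2.span B" "card B = 3"
      using F2.basis_exists[of V] assms(2) by metis
    show "v \<in> F2.span {a, b, c}"
    proof (rule ccontr)
      assume out: "v \<notin> F2.span {a, b, c}"
      then have "F2.independent (insert v {a, b, c})"
        using ind(2) by (rule F2.independent_insertI)
      moreover have "insert v {a, b, c} \<subseteq> F2.span B"
        using v assms(3-5) B(1) by blast
      moreover have "finite B"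
        using B(2) by (simp add: card_ge_0_finite)
      ultimately have "card (insert v {a, b, c}) \<le> 3"
        using F2.independent_span_bound[of B] B(2) by simp
      moreover have "v \<notin> {a, b, c}"
        using out F2.span_base[of v "{a, b, c}"] by blast
      ultimately show False
        using ind(1) by simp
    qed
  qed
  moreover have "F2.span {a, b, c} \<subseteq> V"
    using assms subspace by (intro F2.span_minimal) auto
  ultimately show ?thesis
    using assms by unfold_locales auto
qed

lemma rank_3_standard_basis:
  assumes "code_loop_of_rank L 3" "nonassociative L"
  obtains i m V \<phi> a b c where "i \<in> {1..5}" "code_basis m V a b c" "code_cocycle V \<phi>"
    "L \<cong> code_loop_of V \<phi>" "char_vec_of a b c = lambda_C3 i"
proof -
  obtain m V \<phi> where L: "algebraic_loop L" and V: "double_even_code m V" "F2.dim V = 3"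
    and \<phi>: "code_cocycle V \<phi>" and iso: "L \<cong> code_loop_of V \<phi>"
    using assms(1) by (auto simp: code_loop_of_rank_def)
  interpret code_loop m V \<phi> by unfold_locales fact+
  obtain u v w where "u \<in> V" "v \<in> V" "w \<in> V" "trip u v w = 1"
    using nonassociative_iso[OF L iso assms(2)] nonassociative_iff by blast
  then obtain i a b c where "i \<in> {1..5}" "a \<in> V" "b \<in> V" "c \<in> V" "trip a b c = 1"
    "char_vec_of a b c = lambda_C3 i"
    by (rule standard_basis)
  then show thesis
    using that code_basisI[OF V] \<phi> iso by blast
qed

lemma sign_elem_inject: "sign_elem s = sign_elem t \<longleftrightarrow> s = t"
  by (simp add: sign_elem_eq)

text \<open>The images of the generators span the code. Every value of \<open>trip\<close> is a
  multiple of its value on them, so nonassociativity makes that value 1.\<close>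

lemma has_char_vector_basis:
  assumes L: "algebraic_loop L" and "nonassociative L" "has_char_vector L l"
  obtains m V \<phi> a b c where "code_basis m V a b c" "code_cocycle V \<phi>"
    "L \<cong> code_loop_of V \<phi>" "char_vec_of a b c = l"
proof -
  obtain l1 l2 l3 l4 l5 l6 where l: "l = (l1, l2, l3, l4, l5, l6)"
    by (metis surj_pair)
  obtain x y z m V \<phi> h where V: "double_even_code m V" and \<phi>: "code_cocycle V \<phi>"
    and h: "h \<in> iso L (code_loop_of V \<phi>)" and xyz: "x \<in> carrier L" "y \<in> carrier L" "z \<in> carrier L"
    and span: "F2.span {snd (h x), snd (h y), snd (h z)} = V"
    and vals: "h (x \<otimes>\<^bsub>L\<^esub> x) = sign_elem l1" "h (y \<otimes>\<^bsub>L\<^esub> y) = sign_elem l2"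
      "h (z \<otimes>\<^bsub>L\<^esub> z) = sign_elem l3" "h (loop_commutator L x y) = sign_elem l4"
      "h (loop_commutator L x z) = sign_elem l5" "h (loop_commutator L y z) = sign_elem l6"
    using assms(3) unfolding has_char_vector_def has_char_vector_wrt_def l prod.case by blast
  interpret code_loop m V \<phi> by unfold_locales fact+
  let ?a = "snd (h x)" and ?b = "snd (h y)" and ?c = "snd (h z)"
  have mem: "?a \<in> V" "?b \<in> V" "?c \<in> V"
    using iso_carrier[OF h] xyz by (simp_all add: mem_Times_iff)
  have vec: "char_vec_of ?a ?b ?c = l"
    using vals iso_square[OF h] iso_commutator[OF L h] xyz
    by (simp only: char_vec_of_def l sign_elem_inject)
  obtain u v w where "u \<in> V" "v \<in> V" "w \<in> V" and uvw: "trip u v w = 1"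
    using nonassociative_iso[OF L is_isoI[OF h] assms(2)] nonassociative_iff by blast
  then obtain p q r where "u = comb ?a ?b ?c p" "v = comb ?a ?b ?c q" "w = comb ?a ?b ?c r"
    using span[symmetric] unfolding span_eq_range_comb by blast
  then have "trip ?a ?b ?c = 1"
    using uvw trip_comb[OF mem, of p q r] by (cases "trip ?a ?b ?c = 0") simp_all
  then have "code_basis m V ?a ?b ?c"
    using mem span by unfold_locales
  then show thesis
    using that \<phi> is_isoI[OF h] vec by blast
qed

locale code_loop_basis = code_basis + code_loop
begin

lemma rank_3: "code_loop_of_rank M 3"
  unfolding code_loop_of_rank_def
  using algebraic_loop code cocycle dim_V iso_refl by blast

lemma nonassoc: "nonassociative M"
  using nonassociative_iff mem trip_abc by blast

lemma has_char_vec: "has_char_vector M lam"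
proof -
  have h: "(\<lambda>x. x) \<in> iso M M"
    by (rule iso_set_refl)
  have car: "(1, a) \<in> carrier M" "(1, b) \<in> carrier M" "(1, c) \<in> carrier M"
    using mem by simp_all
  have "has_char_vector_wrt M (1, a) (1, b) (1, c) lam"
    unfolding has_char_vector_wrt_def char_vec_of_def prod.case
    using code cocycle h car span independent_of_trip[OF mem trip_abc] iso_square[OF h]
      iso_commutator[OF algebraic_loop h]
    by (intro exI[of _ m] exI[of _ V] exI[of _ \<phi>] exI[of _ "\<lambda>x. x"]) (simp only: snd_conv simp_thms)
  then show ?thesis
    unfolding has_char_vector_def by blast
qed

lemma quarter_set: "{v \<in> V. quarter v = 1} = comb a b c ` {p. char_poly lam p = 1}"
  unfolding V_eq using quarter_comb by auto

text \<open>The factor 2 counts the two signs above each vector.\<close>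

lemma card_nonunit_squares: "card (nonunit_squares M) = 2 * card {p. char_poly lam p = 1}"
proof -
  have "card (comb a b c ` {p. char_poly lam p = 1}) = card {p. char_poly lam p = 1}"
    by (rule card_image[OF inj_on_subset[OF inj_comb]]) simp
  then show ?thesis
    unfolding nonunit_squares quarter_set card_cartesian_product by simp
qed

lemma has_nonunit_square_line_iff:
  "has_nonunit_square_line M \<longleftrightarrow>
     (\<exists>p q. char_poly lam p = 1 \<and> char_poly lam q = 1 \<and> char_poly lam (p + q) = 1)"
proof
  assume "has_nonunit_square_line M"
  then obtain v w where "v \<in> V" "w \<in> V" and vw: "quarter v = 1" "quarter w = 1" "quarter (v + w) = 1"
    unfolding has_nonunit_square_line_def nonunit_squares by (auto simp: mem_Times_iff)
  then obtain p q where "v = comb a b c p" "w = comb a b c q"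
    unfolding V_eq by blast
  then show "\<exists>p q. char_poly lam p = 1 \<and> char_poly lam q = 1 \<and> char_poly lam (p + q) = 1"
    using vw by (simp only: quarter_comb flip: comb_add) blast
next
  assume "\<exists>p q. char_poly lam p = 1 \<and> char_poly lam q = 1 \<and> char_poly lam (p + q) = 1"
  then obtain p q where pq: "char_poly lam p = 1" "char_poly lam q = 1" "char_poly lam (p + q) = 1"
    by blast
  let ?v = "comb a b c p" and ?w = "comb a b c q"
  have vw: "?v \<in> V" "?w \<in> V" "quarter ?v = 1" "quarter ?w = 1" "quarter (?v + ?w) = 1"
    using mem pq by (simp_all add: quarter_comb flip: comb_add)
  then have "(1, ?v) \<in> nonunit_squares M" "(1, ?w) \<in> nonunit_squares M"
    "(1, ?v) \<otimes>\<^bsub>M\<^esub> (1, ?w) \<in> nonunit_squares M"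
    unfolding nonunit_squares using cocycle_in[of ?v ?w] by simp_all
  then show "has_nonunit_square_line M"
    unfolding has_nonunit_square_line_def by blast
qed

end

section \<open>The five standard forms and their separation\<close>

definition points :: "(bit \<times> bit \<times> bit) list" where
  "points = [(0, 0, 0), (0, 0, 1), (0, 1, 0), (0, 1, 1), (1, 0, 0), (1, 0, 1), (1, 1, 0), (1, 1, 1)]"

lemma in_points: "p \<in> set points"
proof -
  obtain x y z where "p = (x, y, z)" by (metis surj_pair)
  then show ?thesis by (cases x; cases y; cases z) (simp_all add: points_def)
qed

lemma card_char_poly: "card {p. char_poly l p = 1} = length (filter (\<lambda>p. char_poly l p = 1) points)"
proof -
  have "{p. char_poly l p = 1} = set (filter (\<lambda>p. char_poly l p = 1) points)"
    using in_points by auto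
  moreover have "distinct points"
    by (simp add: points_def)
  ultimately show ?thesis
    by (metis distinct_card distinct_filter)
qed

lemma card_lambda_C3:
  "card {p. char_poly (lambda_C3 1) p = 1} = 7" "card {p. char_poly (lambda_C3 2) p = 1} = 1"
  "card {p. char_poly (lambda_C3 3) p = 1} = 3" "card {p. char_poly (lambda_C3 4) p = 1} = 5"
  "card {p. char_poly (lambda_C3 5) p = 1} = 3"
  unfolding card_char_poly by (simp_all add: points_def char_poly_def lambda_C3_def)

lemma line_lambda_C3:
  "\<exists>p q. char_poly (lambda_C3 3) p = 1 \<and> char_poly (lambda_C3 3) q = 1 \<and>
     char_poly (lambda_C3 3) (p + q) = 1"
  \<comment> \<open>This form is 1 exactly at the three points of weight 2, and they make up a
    line.\<close>
  by (intro exI[of _ "(1, 1, 0)"] exI[of _ "(1, 0, 1)"]) (simp add: char_poly_def lambda_C3_def)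

text \<open>The form is \<open>x * (1 + y * z)\<close>: points with value 1 have
  \<open>x = 1\<close>, so the sum of two of them has \<open>x = 0\<close>.\<close>

lemma no_line_lambda_C3:
  "char_poly (lambda_C3 5) p = 1 \<Longrightarrow> char_poly (lambda_C3 5) q = 1 \<Longrightarrow>
     char_poly (lambda_C3 5) (p + q) \<noteq> 1"
proof -
  obtain x y z x' y' z' where "p = (x, y, z)" "q = (x', y', z')" by (metis surj_pair)
  then show "char_poly (lambda_C3 5) p = 1 \<Longrightarrow> char_poly (lambda_C3 5) q = 1 \<Longrightarrow>
     char_poly (lambda_C3 5) (p + q) \<noteq> 1"
    by (cases x; cases x') (simp_all add: char_poly_def lambda_C3_def)
qed

lemma C3_not_isomorphic:
  assumes "is_C3 i K" "is_C3 j L" "K \<cong> L" "i \<in> {1..5}" "j \<in> {1..5}"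
  shows "i = j"
proof -
  have K: "algebraic_loop K" "nonassociative K" "has_char_vector K (lambda_C3 i)"
    and L: "algebraic_loop L" "nonassociative L" "has_char_vector L (lambda_C3 j)"
    using assms(1,2) by (auto simp: is_C3_def code_loop_of_rank_def)
  obtain m V \<phi> a b c where basis: "code_basis m V a b c" "code_cocycle V \<phi>"
    "K \<cong> code_loop_of V \<phi>" and lam: "char_vec_of a b c = lambda_C3 i"
    using has_char_vector_basis[OF K] .
  obtain m' V' \<phi>' a' b' c' where basis': "code_basis m' V' a' b' c'" "code_cocycle V' \<phi>'"
    "L \<cong> code_loop_of V' \<phi>'" and lam': "char_vec_of a' b' c' = lambda_C3 j"
    using has_char_vector_basis[OF L] .
  interpret B: code_basis m V a b c by fact
  interpret B: code_loop_basis m V a b c \<phi> by unfold_locales fact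
  interpret B': code_basis m' V' a' b' c' by fact
  interpret B': code_loop_basis m' V' a' b' c' \<phi>' by unfold_locales fact
  have iso: "code_loop_of V \<phi> \<cong> code_loop_of V' \<phi>'"
    using iso_trans[OF loop_iso_sym[OF K(1) basis(3)] iso_trans[OF assms(3) basis'(3)]] .
  then have iso': "code_loop_of V' \<phi>' \<cong> code_loop_of V \<phi>"
    by (rule loop_iso_sym[OF B.algebraic_loop])
  have card: "card {p. char_poly (lambda_C3 i) p = 1} = card {p. char_poly (lambda_C3 j) p = 1}"
    using loop_iso_invariants(1)[OF B.algebraic_loop B'.algebraic_loop iso]
    unfolding B.card_nonunit_squares B'.card_nonunit_squares lam lam' by simp
  have line: "has_nonunit_square_line (code_loop_of V \<phi>) \<longleftrightarrow> has_nonunit_square_line (code_loop_of V' \<phi>')"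
    using loop_iso_invariants(2)[OF B.algebraic_loop B'.algebraic_loop iso]
      loop_iso_invariants(2)[OF B'.algebraic_loop B.algebraic_loop iso'] by blast
  have "i \<in> {1, 2, 3, 4, 5}" "j \<in> {1, 2, 3, 4, 5}"
    using assms(4,5) by auto
  \<comment> \<open>The counts 7, 1, 3, 5, 3 agree only for the indices 3 and 5, which the line
    separates.\<close>
  moreover have "\<not> (i = 3 \<and> j = 5)" "\<not> (i = 5 \<and> j = 3)"
    using line line_lambda_C3 no_line_lambda_C3
    unfolding B.has_nonunit_square_line_iff B'.has_nonunit_square_line_iff lam lam' by blast+
  ultimately show ?thesis
    using card card_lambda_C3 by fastforce
qed

subsection \<open>Five codes\<close>

text \<open>With \<open>cs\<close> the columns of a generator matrix and \<open>P\<close> a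
  coordinate function, this is a row of the matrix. Weights of rows and of their products become
  counts of columns.\<close>

definition column_vec :: "'a list \<Rightarrow> ('a \<Rightarrow> bit) \<Rightarrow> f2vec" where
  "column_vec cs P = (\<lambda>i. if i < length cs then P (cs ! i) else 0)"

lemma wt_column_vec: "wt (column_vec cs P) = length (filter (\<lambda>p. P p = 1) cs)"
proof -
  have "{i. column_vec cs P i = 1} = {i. i < length cs \<and> P (cs ! i) = 1}"
    by (auto simp: column_vec_def split: if_splits)
  then show ?thesis
    by (simp add: wt_def length_filter_conv_card)
qed

lemma column_vec_mult: "column_vec cs P * column_vec cs Q = column_vec cs (\<lambda>p. P p * Q p)"
  by (simp add: column_vec_def fun_eq_iff)

lemma column_vec_in: "column_vec cs P \<in> f2_space (length cs)"
  by (simp add: column_vec_def f2_space_def)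

text \<open>
  \<open>C3_columns i\<close> lists the columns of a generator matrix.  Modulo 8, 4 and 2 the multiplicities of
  the columns of weight 1, 2 and 3 are forced by \<open>lambda_C3 i\<close>.
\<close>

definition C3_columns :: "nat \<Rightarrow> (bit \<times> bit \<times> bit) list" where
  "C3_columns i =
     (let k = (if i = 1 \<or> i = 3 then 1 else 3);
          (k1, k2, k3) =
            (if i = 3 then (5, 5, 5) else if i = 4 then (5, 5, 1) else if i = 5 then (5, 1, 1)
             else (1, 1, 1))
      in replicate k1 (1, 0, 0) @ replicate k2 (0, 1, 0) @ replicate k3 (0, 0, 1) @
         replicate k (1, 1, 0) @ replicate k (1, 0, 1) @ replicate k (0, 1, 1) @ [(1, 1, 1)])"

text \<open>The rows of the generator matrix serve as basis. The column \<open>(1, 1, 1)\<close>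
  occurs once, which makes \<open>trip\<close> equal to 1.\<close>

lemma C3_code_exists:
  assumes "i \<in> {1..5}"
  obtains m V a b c where "code_basis m V a b c" "char_vec_of a b c = lambda_C3 i"
proof -
  let ?cs = "C3_columns i"
  define a where "a = column_vec ?cs fst"
  define b where "b = column_vec ?cs (\<lambda>p. fst (snd p))"
  define c where "c = column_vec ?cs (\<lambda>p. snd (snd p))"
  note wts = a_def b_def c_def wt2_eq_wt wt3_eq_wt column_vec_mult wt_column_vec C3_columns_def
  have i: "i = 1 \<or> i = 2 \<or> i = 3 \<or> i = 4 \<or> i = 5"
    using assms by auto
  have dvd: "4 dvd wt a" "4 dvd wt b" "4 dvd wt c" "2 dvd wt2 a b" "2 dvd wt2 a c" "2 dvd wt2 b c"
    using i by (auto simp: wts) (simp_all add: numeral_eq_Suc)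
  have lam: "char_vec_of a b c = lambda_C3 i"
    using i by (auto simp: char_vec_of_def quarter_def half_def lambda_C3_def wts)
  have trip: "trip a b c = 1"
    using i by (auto simp: trip_def wts)
  have self: "wt2 v v = wt v" for v
  proof -
    have "v * v = v" by (auto simp: fun_eq_iff bit_ring)
    then show ?thesis by (simp add: wt2_eq_wt)
  qed
  have comm: "wt2 v w = wt2 w v" for v w
    by (simp add: wt2_eq_wt mult.commute)
  let ?V = "F2.span {a, b, c}"
  have "double_even_code (length ?cs) ?V"
  proof (rule double_even_code_span)
    show "{a, b, c} \<subseteq> f2_space (length ?cs)"
      by (simp add: a_def b_def c_def column_vec_in)
    show "4 dvd wt v" if "v \<in> {a, b, c}" for v
      using that dvd by auto
    have "2 dvd wt v" if "v \<in> {a, b, c}" for v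
      using that dvd(1-3) by (auto intro: dvd_trans[of 2 4])
    then show "2 dvd wt2 v w" if "v \<in> {a, b, c}" "w \<in> {a, b, c}" for v w
      using that dvd(4-6) self comm by (metis insertE singletonD)
  qed
  then have "code_basis (length ?cs) ?V a b c"
    using trip by unfold_locales (auto simp: F2.span_base)
  then show thesis
    using that lam by blast
qed

text \<open>The loops are fixed only by their characteristic vectors, so the classification is
  stated for every choice \<open>C\<close>. The first conjunct shows that such choices exist on
  \<open>int \<times> f2vec\<close>.\<close>

theorem theorem3:
  shows "(\<forall>i\<in>{1..5}. \<exists>K :: (int \<times> f2vec) monoid. is_C3 i K) \<and>
    (\<forall>C :: nat \<Rightarrow> 'a monoid. (\<forall>i\<in>{1..5}. is_C3 i (C i)) \<longrightarrow>
       (\<forall>i\<in>{1..5}. \<forall>j\<in>{1..5}. i \<noteq> j \<longrightarrow> \<not> C i \<cong> C j) \<and>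
       (\<forall>L :: 'b monoid. code_loop_of_rank L 3 \<and> nonassociative L \<longrightarrow>
          (\<exists>i\<in>{1..5}. L \<cong> C i)))"
proof (intro conjI ballI allI impI)
  fix i :: nat assume i: "i \<in> {1..5}"
  obtain m V a b c where basis: "code_basis m V a b c" and lam: "char_vec_of a b c = lambda_C3 i"
    using C3_code_exists[OF i] .
  interpret B: code_basis m V a b c by fact
  obtain \<phi> where "code_cocycle V \<phi>"
    using B.cocycle_exists by blast
  then interpret B: code_loop_basis m V a b c \<phi> by unfold_locales
  have "is_C3 i (code_loop_of V \<phi>)"
    unfolding is_C3_def using B.rank_3 B.nonassoc B.has_char_vec lam by simp
  then show "\<exists>K :: (int \<times> f2vec) monoid. is_C3 i K" by blast
next
  fix C :: "nat \<Rightarrow> 'a monoid" and i j :: nat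
  assume "\<forall>i\<in>{1..5}. is_C3 i (C i)" "i \<in> {1..5}" "j \<in> {1..5}" "i \<noteq> j"
  then show "\<not> C i \<cong> C j"
    using C3_not_isomorphic by blast
next
  fix C :: "nat \<Rightarrow> 'a monoid" and L :: "'b monoid"
  assume C: "\<forall>i\<in>{1..5}. is_C3 i (C i)" and "code_loop_of_rank L 3 \<and> nonassociative L"
  then obtain i m V \<phi> a b c where i: "i \<in> {1..5}" and basis: "code_basis m V a b c"
    and \<phi>: "code_cocycle V \<phi>" and iso: "L \<cong> code_loop_of V \<phi>"
    and lam: "char_vec_of a b c = lambda_C3 i"
    using rank_3_standard_basis by metis
  have Ci: "algebraic_loop (C i)" "nonassociative (C i)" "has_char_vector (C i) (lambda_C3 i)"
    using C i by (auto simp: is_C3_def code_loop_of_rank_def)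
  obtain m' V' \<phi>' a' b' c' where basis': "code_basis m' V' a' b' c'"
    and \<phi>': "code_cocycle V' \<phi>'" and iso': "C i \<cong> code_loop_of V' \<phi>'"
    and lam': "char_vec_of a' b' c' = lambda_C3 i"
    using has_char_vector_basis[OF Ci] .
  \<comment> \<open>\<open>L\<close> and \<open>C i\<close> have been replaced by loops of codes
    whose bases share the vector \<open>lambda_C3 i\<close>.\<close>
  have "code_loop_of V \<phi> \<cong> code_loop_of V' \<phi>'"
    using code_basis_iso[OF basis basis' _ \<phi> \<phi>'] lam lam' by simp
  then have "L \<cong> C i"
    using iso_trans[OF iso] iso_trans loop_iso_sym[OF Ci(1) iso'] by blast
  then show "\<exists>i\<in>{1..5}. L \<cong> C i"
    using i by blast
qed

end
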